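(* Let $f:\mathbb{T}\to[0,1]$ be a Borel function with $\sigma:=\int_{\mathbb{T}} f\,d\mathfrak{m}\in(0,1)$, let $\mathfrak{X}$ be the determinantal point process on $\mathbb{Z}$ induced by the kernel $K_f(n,m)=\widehat{f}(n-m)$, defined on a probability space $(\Omega,\mathcal{A},\mathbb{P})$, and let $\xi_n(\omega)\in\{0,1\}$ be the indicator of $n\in\mathfrak{X}(\omega)$. There exists an event $\Omega_0\subset\Omega$ with $\mathbb{P}(\Omega_0)=1$ such that each $\omega\in\Omega_0$ has the following property: for any polynomial $P\in\mathbb{Z}[x]$ with $\deg P\ge 1$ and $P(\mathbb{N})\subset\mathbb{N}$, any measure-preserving dynamical system $(X,\mathcal{B},\nu,T)$, any real $r>1$ and any $g\in L^r(X,\mathcal{B},\nu)$, the limit $$\lim_{N\to\infty}\frac1N\sum_{n=0}^{N-1}(\xi_n(\omega)-\sigma)\,g(T^{P(n)}x)=0$$ holds for $\nu$-almost every $x\in X$ and in $L^r$-norm.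
   Context: $\mathbb{T}=\mathbb{R}/\mathbb{Z}$ with normalized Lebesgue measure $\mathfrak{m}$; $\widehat{f}(n)=\int_{\mathbb{T}} f(t)e^{-2\pi i n t}\,d\mathfrak{m}(t)$; $\mathbb{N}$ is the set of non-negative integers. The (stationary) determinantal point process $\mathfrak{X}$ induced by $K_f$ is the random subset of $\mathbb{Z}$ whose indicator random variables $\xi_n$ satisfy, for all distinct $n_1,\dots,n_k\in\mathbb{Z}$, $\mathbb{E}(\xi_{n_1}\cdots\xi_{n_k})=\det(\widehat{f}(n_i-n_j))_{1\le i,j\le k}$. Such a process exists and its law is uniquely determined by $f$. A measure-preserving dynamical system $(X,\mathcal{B},\nu,T)$ is a probability space with a measurable map $T:X\to X$ preserving $\nu$. *)

theory Defs
  imports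
    "HOL-Probability.Probability"
    "HOL-Computational_Algebra.Polynomial"
    "Jordan_Normal_Form.Determinant"
begin

text \<open>A function on \<open>\<real>/\<int>\<close> is represented by a 1-periodic function on \<open>\<real>\<close>; integrals over the
  circle are integrals over the fundamental domain \<open>{0..<1}\<close>.\<close>

definition fourier_coeff :: "(real \<Rightarrow> real) \<Rightarrow> int \<Rightarrow> complex" where
  "fourier_coeff f n =
     (LINT t:{0..<1}|lborel. complex_of_real (f t) * exp (- 2 * of_real pi * \<i> * of_int n * of_real t))"

text \<open>Here \<open>\<X> \<omega>\<close> is the random subset of \<open>\<int>\<close>, and \<open>indicator (\<X> \<omega>) n\<close> is the variable \<open>\<xi>\<^sub>n\<close>.\<close>

definition determinantal_process ::
    "'a measure \<Rightarrow> (int \<Rightarrow> int \<Rightarrow> complex) \<Rightarrow> ('a \<Rightarrow> int set) \<Rightarrow> bool" where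
  "determinantal_process \<Omega> K \<X> \<longleftrightarrow>
     prob_space \<Omega> \<and>
     (\<forall>n. {\<omega> \<in> space \<Omega>. n \<in> \<X> \<omega>} \<in> sets \<Omega>) \<and>
     (\<forall>ns. distinct ns \<longrightarrow>
        complex_of_real (LINT \<omega>|\<Omega>. (\<Prod>n\<leftarrow>ns. indicat_real (\<X> \<omega>) n)) =
        Determinant.det (Matrix.mat (length ns) (length ns) (\<lambda>(i, j). K (ns ! i) (ns ! j))))"

definition mp_system :: "'x measure \<Rightarrow> ('x \<Rightarrow> 'x) \<Rightarrow> bool" where
  "mp_system M T \<longleftrightarrow> prob_space M \<and> T \<in> M \<rightarrow>\<^sub>M M \<and> distr M M T = M"

definition Lspace :: "'x measure \<Rightarrow> real \<Rightarrow> ('x \<Rightarrow> complex) set" where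
  "Lspace M r = {g \<in> borel_measurable M. integrable M (\<lambda>x. norm (g x) powr r)}"

definition Lnorm :: "'x measure \<Rightarrow> real \<Rightarrow> ('x \<Rightarrow> complex) \<Rightarrow> real" where
  "Lnorm M r g = (LINT x|M. norm (g x) powr r) powr (1 / r)"

definition Lconv_zero :: "'x measure \<Rightarrow> real \<Rightarrow> (nat \<Rightarrow> 'x \<Rightarrow> complex) \<Rightarrow> bool" where
  "Lconv_zero M r G \<longleftrightarrow> (\<forall>N. G N \<in> Lspace M r) \<and> (\<lambda>N. Lnorm M r (G N)) \<longlonglongrightarrow> 0"

definition weighted_average ::
    "(nat \<Rightarrow> real) \<Rightarrow> int poly \<Rightarrow> ('x \<Rightarrow> 'x) \<Rightarrow> ('x \<Rightarrow> complex) \<Rightarrow> nat \<Rightarrow> 'x \<Rightarrow> complex" where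
  "weighted_average w P T g N x =
     (1 / of_nat N) * (\<Sum>n<N. of_real (w n) * g ((T ^^ nat (poly P (int n))) x))"

text \<open>The weights \<open>w\<close> annihilate all polynomial ergodic averages on systems whose phase space has
  type \<open>'x\<close>. (HOL cannot quantify over types inside a formula, so the type is a parameter.)\<close>

definition averages_vanish :: "'x itself \<Rightarrow> (nat \<Rightarrow> real) \<Rightarrow> bool" where
  "averages_vanish ty w \<longleftrightarrow>
     (\<forall>(P :: int poly) (M :: 'x measure) T r g.
        degree P \<ge> 1 \<longrightarrow> (\<forall>n::nat. poly P (int n) \<ge> 0) \<longrightarrow>
        mp_system M T \<longrightarrow> r > 1 \<longrightarrow> g \<in> Lspace M r \<longrightarrow>
          (AE x in M. (\<lambda>N. weighted_average w P T g N x) \<longlonglongrightarrow> 0) \<and>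
          Lconv_zero M r (weighted_average w P T g))"

end

theory Submission
  imports Defs "HOL-Library.Real_Mod" "HOL-Number_Theory.Cong"
begin

text \<open>Hadamard's inequality for the positive semidefinite Toeplitz matrices of \<open>f\<close> gives
  \<open>E (\<Prod>n\<in>S. \<xi>\<^sub>n) \<le> \<sigma> ^ card S\<close>, hence the exponential moments of sums of the \<open>\<xi>\<^sub>n\<close> with nonnegative
  coefficients are at most those of independent Bernoulli variables. A union bound over polynomially
  many roots of unity shows that almost surely, for every \<open>P\<close>, the sums
  \<open>\<Sum>n<N. (\<xi>\<^sub>n - \<sigma>) e(j P(n) / K)\<close> are \<open>O(N powr (3/4))\<close> along polynomially growing \<open>N\<close>. By transference
  to \<open>\<int>/K\<close> the averages then decay like a power of \<open>N\<close> in operator norm on \<open>L\<^sup>2\<close>. For \<open>g \<in> L\<^sup>r\<close>, truncating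
  \<open>g\<close> at a small power of \<open>N\<close> gives almost everywhere convergence along \<open>N = k\<^sup>m\<close> with \<open>m\<close> large, and the
  blocks between consecutive \<open>k\<^sup>m\<close> contribute \<open>O(1/k)\<close> in \<open>L\<^sup>r\<close>, whose \<open>r\<close>-th powers are summable because
  \<open>r > 1\<close>; so Bourgain's maximal inequality is not needed.\<close>

section \<open>Hadamard's inequality\<close>

text \<open>One step of Gaussian elimination in block form: \<open>?L\<close> is unit lower
  triangular and \<open>?U\<close> block upper triangular with the Schur complement
  \<open>?S\<close> as lower right block, so both determinants can be read off.\<close>

lemma det_Schur_complement:
  fixes a :: "nat \<Rightarrow> nat \<Rightarrow> 'a :: field"
  assumes "a 0 0 \<noteq> 0"
  shows "Determinant.det (Matrix.mat (Suc n) (Suc n) (\<lambda>(i, j). a i j)) =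
    a 0 0 * Determinant.det (Matrix.mat n n (\<lambda>(i, j). a (Suc i) (Suc j) - a (Suc i) 0 * a 0 (Suc j) / a 0 0))"
    (is "_ = _ * Determinant.det ?S")
proof -
  let ?one = "Matrix.mat 1 1 (\<lambda>_. 1) :: 'a Matrix.mat"
  let ?a = "Matrix.mat 1 1 (\<lambda>_. a 0 0)"
  let ?row = "Matrix.mat 1 n (\<lambda>(i, j). a 0 (Suc j))"
  let ?col = "Matrix.mat n 1 (\<lambda>(i, j). a (Suc i) 0 / a 0 0)"
  let ?L = "four_block_mat ?one (0\<^sub>m 1 n) ?col (1\<^sub>m n)"
  let ?U = "four_block_mat ?a ?row (0\<^sub>m n 1) ?S"
  have "?L * ?U = four_block_mat (?one * ?a + 0\<^sub>m 1 n * 0\<^sub>m n 1) (?one * ?row + 0\<^sub>m 1 n * ?S)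
      (?col * ?a + 1\<^sub>m n * 0\<^sub>m n 1) (?col * ?row + 1\<^sub>m n * ?S)"
    by (rule mult_four_block_mat) auto
  also have "\<dots> = Matrix.mat (Suc n) (Suc n) (\<lambda>(i, j). a i j)"
    using assms by (intro eq_matI) (auto simp: scalar_prod_def less_Suc_eq_0_disj)
  finally have eq: "Matrix.mat (Suc n) (Suc n) (\<lambda>(i, j). a i j) = ?L * ?U" ..
  have "Determinant.det ?L = Determinant.det ?one * Determinant.det (1\<^sub>m n :: 'a Matrix.mat)"
    by (rule det_four_block_mat_upper_right_zero) auto
  moreover have "Determinant.det ?U = Determinant.det ?a * Determinant.det ?S"
    by (rule det_four_block_mat_lower_left_zero) auto
  moreover have "?L \<in> carrier_mat (Suc n) (Suc n)" "?U \<in> carrier_mat (Suc n) (Suc n)"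
    using four_block_carrier_mat[of ?one 1 1 "1\<^sub>m n" n n] four_block_carrier_mat[of ?a 1 1 ?S n n] by auto
  ultimately show ?thesis
    unfolding eq by (simp add: det_mult[of _ "Suc n"] det_single)
qed

text \<open>Entries are a function of the indices, so deleting the first row and column is a shift
  by \<open>Suc\<close>. Hermitian symmetry makes the form real, so \<open>Re\<close> loses
  nothing.\<close>

definition pos_semidef :: "nat \<Rightarrow> (nat \<Rightarrow> nat \<Rightarrow> complex) \<Rightarrow> bool" where
  "pos_semidef n a \<longleftrightarrow> (\<forall>i<n. \<forall>j<n. a j i = cnj (a i j)) \<and>
     (\<forall>v. 0 \<le> Re (\<Sum>i<n. \<Sum>j<n. cnj (v i) * a i j * v j))"

text \<open>Isolates the first coordinate \<open>z\<close> of the test vector. For fixed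
  \<open>v\<close>, a suitable choice of \<open>z\<close> settles each case of Hadamard's
  inequality.\<close>

lemma pos_semidef_Suc_form:
  assumes "pos_semidef (Suc n) a"
  shows "0 \<le> Re (a 0 0) * (norm z)\<^sup>2 + 2 * Re (cnj z * (\<Sum>j<n. a 0 (Suc j) * v j))
    + Re (\<Sum>i<n. \<Sum>j<n. cnj (v i) * a (Suc i) (Suc j) * v j)"
proof -
  let ?v = "\<lambda>i. case i of 0 \<Rightarrow> z | Suc i \<Rightarrow> v i"
  let ?R = "\<Sum>j<n. a 0 (Suc j) * v j"
  have herm: "a j i = cnj (a i j)" if "i < Suc n" "j < Suc n" for i j
    using assms that unfolding pos_semidef_def by blast
  have "cnj (a 0 0) = a 0 0" by (rule herm[symmetric]) auto
  hence a00: "a 0 0 = complex_of_real (Re (a 0 0))"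
    by (metis Reals_cnj_iff of_real_Re)
  have col: "(\<Sum>i<n. cnj (v i) * a (Suc i) 0) = cnj ?R"
  proof -
    have "a (Suc i) 0 = cnj (a 0 (Suc i))" if "i < n" for i
      using herm[of 0 "Suc i"] that by simp
    thus ?thesis by (simp add: mult.commute)
  qed
  have "(\<Sum>i<Suc n. \<Sum>j<Suc n. cnj (?v i) * a i j * ?v j) =
     cnj z * a 0 0 * z + (\<Sum>j<n. cnj z * a 0 (Suc j) * v j)
      + ((\<Sum>i<n. cnj (v i) * a (Suc i) 0 * z) + (\<Sum>i<n. \<Sum>j<n. cnj (v i) * a (Suc i) (Suc j) * v j))"
    unfolding sum.lessThan_Suc_shift by (simp add: sum.distrib)
  also have "(\<Sum>j<n. cnj z * a 0 (Suc j) * v j) = cnj z * ?R"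
    by (simp add: sum_distrib_left mult.assoc)
  also have "(\<Sum>i<n. cnj (v i) * a (Suc i) 0 * z) = cnj (cnj z * ?R)"
    by (subst sum_distrib_right[symmetric]) (simp add: col)
  also have "cnj z * a 0 0 * z = complex_of_real (Re (a 0 0) * (norm z)\<^sup>2)"
  proof -
    have "z * cnj z = (complex_of_real (norm z))\<^sup>2"
      using complex_norm_square[of z] by simp
    thus ?thesis by (subst a00) (simp add: mult_ac)
  qed
  finally have eq: "Re (\<Sum>i<Suc n. \<Sum>j<Suc n. cnj (?v i) * a i j * ?v j) =
    Re (a 0 0) * (norm z)\<^sup>2 + 2 * Re (cnj z * ?R) + Re (\<Sum>i<n. \<Sum>j<n. cnj (v i) * a (Suc i) (Suc j) * v j)"
    by (simp only: plus_complex.sel cnj.sel Re_complex_of_real mult_2 add.assoc)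
  have "0 \<le> Re (\<Sum>i<Suc n. \<Sum>j<Suc n. cnj (?v i) * a i j * ?v j)"
    using assms unfolding pos_semidef_def by blast
  thus ?thesis unfolding eq .
qed

text \<open>Induction by elimination. A positive pivot leaves a Schur complement that is again
  positive semidefinite and whose diagonal entries have not grown; a zero pivot forces the first row
  to vanish.\<close>

lemma Hadamard_inequality:
  assumes "pos_semidef n a"
  shows "\<exists>d. Determinant.det (Matrix.mat n n (\<lambda>(i, j). a i j)) = complex_of_real d \<and>
    0 \<le> d \<and> d \<le> (\<Prod>i<n. Re (a i i)) \<and> (\<forall>i<n. 0 \<le> Re (a i i))"
  using assms
proof (induction n arbitrary: a)
  case 0
  show ?case by (rule exI[of _ 1]) auto
next
  case (Suc n)
  note form = pos_semidef_Suc_form[OF Suc.prems]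
  have herm: "a j i = cnj (a i j)" if "i < Suc n" "j < Suc n" for i j
    using Suc.prems that unfolding pos_semidef_def by blast
  have "cnj (a 0 0) = a 0 0" by (rule herm[symmetric]) auto
  hence a00: "a 0 0 = complex_of_real (Re (a 0 0))"
    by (metis Reals_cnj_iff of_real_Re)
  have "pos_semidef n (\<lambda>i j. a (Suc i) (Suc j))"
    unfolding pos_semidef_def 
  proof safe
    fix i j assume "i < n" "j < n"
    thus "a (Suc j) (Suc i) = cnj (a (Suc i) (Suc j))" by (intro herm) auto
  next
    fix v :: "nat \<Rightarrow> complex"
    show "0 \<le> Re (\<Sum>i<n. \<Sum>j<n. cnj (v i) * a (Suc i) (Suc j) * v j)"
      using form[of 0 v] by simp
  qed
  from Suc.IH[OF this] have diag: "\<forall>i<n. 0 \<le> Re (a (Suc i) (Suc i))" by blast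
  have nonneg: "0 \<le> Re (a 0 0)"
    using form[of 1 "\<lambda>_. 0"] by simp
  have diag': "\<forall>i<Suc n. 0 \<le> Re (a i i)"
    using diag nonneg by (auto simp: less_Suc_eq_0_disj)
  show ?case
  proof (cases "Re (a 0 0) = 0")
    case True
    \<comment> \<open>With a zero pivot the form is affine in \<open>t\<close> along
      \<open>z = - t * R\<close>, with a negative slope unless \<open>R = 0\<close>; it could not
      stay nonnegative for all \<open>t\<close>.\<close>
    have R0: "(\<Sum>j<n. a 0 (Suc j) * v j) = 0" for v
    proof (rule ccontr)
      define R where "R = (\<Sum>j<n. a 0 (Suc j) * v j)"
      define F where "F = Re (\<Sum>i<n. \<Sum>j<n. cnj (v i) * a (Suc i) (Suc j) * v j)"
      assume "(\<Sum>j<n. a 0 (Suc j) * v j) \<noteq> 0"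
      hence R: "(norm R)\<^sup>2 > 0" by (simp add: R_def)
      have "0 \<le> 2 * Re (cnj (- complex_of_real t * R) * R) + F" for t
        using form[of "- complex_of_real t * R" v] True by (simp add: R_def F_def)
      also have "Re (cnj (- complex_of_real t * R) * R) = - t * (norm R)\<^sup>2" for t
        using cmod_power2[of R] by (simp add: power2_eq_square algebra_simps)
      finally have "2 * t * (norm R)\<^sup>2 \<le> F" for t by (simp add: mult_ac)
      from this[of "(F + 1) / (2 * (norm R)\<^sup>2)"] R show False by (simp add: field_simps)
    qed
    have "a 0 (Suc j) = 0" if "j < n" for j
      using R0[of "\<lambda>i. if i = j then 1 else 0"] that by (simp add: if_distrib sum.If_cases cong: if_cong)
    hence row0: "a 0 j = 0" if "j < Suc n" for j
      using a00 True that by (cases j) auto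
    have "Determinant.det (Matrix.mat (Suc n) (Suc n) (\<lambda>(i, j). a i j)) = 0"
      by (subst laplace_expansion_row[of _ "Suc n" 0]) (auto simp: row0)
    thus ?thesis
      using diag' by (intro exI[of _ 0]) (auto intro!: prod_nonneg simp del: prod.lessThan_Suc)
  next
    case False
    define s where "s = (\<lambda>i j. a (Suc i) (Suc j) - a (Suc i) 0 * a 0 (Suc j) / a 0 0)"
    have pos: "Re (a 0 0) > 0" using False nonneg by simp
    have col: "a (Suc i) 0 = cnj (a 0 (Suc i))" if "i < n" for i
      using herm[of 0 "Suc i"] that by simp
    have "pos_semidef n s"
      unfolding pos_semidef_def
    proof safe
      fix i j assume "i < n" "j < n"
      hence "a (Suc j) (Suc i) = cnj (a (Suc i) (Suc j))" "a (Suc j) 0 = cnj (a 0 (Suc j))" "a (Suc i) 0 = cnj (a 0 (Suc i))"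
        by (intro herm; simp)+
      thus "s j i = cnj (s i j)"
        using \<open>cnj (a 0 0) = a 0 0\<close> by (simp add: s_def)
    next
      fix v :: "nat \<Rightarrow> complex"
      define R where "R = (\<Sum>j<n. a 0 (Suc j) * v j)"
      have "(\<Sum>i<n. \<Sum>j<n. cnj (v i) * s i j * v j) =
        (\<Sum>i<n. \<Sum>j<n. cnj (v i) * a (Suc i) (Suc j) * v j) -
        (\<Sum>i<n. \<Sum>j<n. (cnj (v i) * cnj (a 0 (Suc i))) * (a 0 (Suc j) * v j)) / a 0 0"
        unfolding sum_divide_distrib sum_subtractf[symmetric]
        by (intro sum.cong refl) (simp add: s_def col field_simps)
      also have "(\<Sum>i<n. \<Sum>j<n. (cnj (v i) * cnj (a 0 (Suc i))) * (a 0 (Suc j) * v j)) = R * cnj R"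
        by (subst sum_product[symmetric]) (simp add: R_def mult.commute)
      also have "R * cnj R / a 0 0 = complex_of_real ((norm R)\<^sup>2 / Re (a 0 0))"
        by (subst a00, subst complex_norm_square[symmetric]) simp
      finally have eq: "Re (\<Sum>i<n. \<Sum>j<n. cnj (v i) * s i j * v j) =
        Re (\<Sum>i<n. \<Sum>j<n. cnj (v i) * a (Suc i) (Suc j) * v j) - (norm R)\<^sup>2 / Re (a 0 0)" by simp
      \<comment> \<open>Completing the square: \<open>z = - R / a 0 0\<close> minimizes the form of
        \<open>a\<close> over the first coordinate, and the minimum is the form of
        \<open>s\<close>.\<close>
      have "Re (a 0 0) * (norm (- R / a 0 0))\<^sup>2 = (norm R)\<^sup>2 / Re (a 0 0)"
        using pos by (subst (2) a00) (simp add: norm_divide power2_eq_square)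
      moreover have "cnj (- R / a 0 0) * R = complex_of_real (- (norm R)\<^sup>2 / Re (a 0 0))"
      proof -
        have "cnj (- R / a 0 0) * R = - (R * cnj R) / a 0 0"
          using \<open>cnj (a 0 0) = a 0 0\<close> by (simp add: mult.commute)
        also have "\<dots> = complex_of_real (- (norm R)\<^sup>2 / Re (a 0 0))"
          by (subst a00, subst complex_norm_square[symmetric]) simp
        finally show ?thesis .
      qed
      ultimately show "0 \<le> Re (\<Sum>i<n. \<Sum>j<n. cnj (v i) * s i j * v j)"
        unfolding eq using form[of "- R / a 0 0" v] unfolding R_def[symmetric] by simp
    qed
    from Suc.IH[OF this] obtain d where
      d: "Determinant.det (Matrix.mat n n (\<lambda>(i, j). s i j)) = complex_of_real d"
         "0 \<le> d" "d \<le> (\<Prod>i<n. Re (s i i))" "\<forall>i<n. 0 \<le> Re (s i i)" by blast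
    have "Re (s i i) \<le> Re (a (Suc i) (Suc i))" if "i < n" for i
    proof -
      have "a (Suc i) 0 * a 0 (Suc i) / a 0 0 = complex_of_real ((norm (a 0 (Suc i)))\<^sup>2 / Re (a 0 0))"
        using that col[of i] complex_norm_square[of "a 0 (Suc i)"]
        by (subst a00) (simp add: mult.commute)
      thus ?thesis using pos by (simp add: s_def)
    qed
    hence "d \<le> (\<Prod>i<n. Re (a (Suc i) (Suc i)))"
      using d by (intro order.trans[OF d(3)] prod_mono) auto
    moreover have "Determinant.det (Matrix.mat (Suc n) (Suc n) (\<lambda>(i, j). a i j)) =
        complex_of_real (Re (a 0 0) * d)"
    proof -
      have "a 0 0 \<noteq> 0" using False by auto
      thus ?thesis using det_Schur_complement[of a n] d(1) a00 unfolding s_def by simp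
    qed
    ultimately show ?thesis
      using diag' pos d(2)
      by (intro exI[of _ "Re (a 0 0) * d"]) (auto simp: prod.lessThan_Suc_shift simp del: prod.lessThan_Suc)
  qed
qed

section \<open>Concentration\<close>

text \<open>All of the determinantal structure that the concentration argument uses. Independent
  Bernoulli variables give equality in the last assumption.\<close>

locale sub_bernoulli = prob_space +
  fixes \<xi> :: "nat \<Rightarrow> 'a \<Rightarrow> real" and s :: real
  assumes measurable_xi [measurable]: "\<xi> n \<in> borel_measurable M"
    and xi_cases: "\<xi> n \<omega> = 0 \<or> \<xi> n \<omega> = 1"
    and expectation_xi: "expectation (\<xi> n) = s"
    and expectation_prod_xi: "finite S \<Longrightarrow> expectation (\<lambda>\<omega>. \<Prod>n\<in>S. \<xi> n \<omega>) \<le> s ^ card S"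
begin

lemma xi_bounds: "0 \<le> \<xi> n \<omega>" "\<xi> n \<omega> \<le> 1" "\<bar>\<xi> n \<omega>\<bar> \<le> 1"
  using xi_cases[of n \<omega>] by auto

lemma integrable_xi [simp]: "integrable M (\<xi> n)"
  by (rule integrable_const_bound[of _ 1]) (auto simp: xi_bounds)

lemma s_bounds: "0 \<le> s" "s \<le> 1"
proof -
  show "0 \<le> s"
    unfolding expectation_xi[of 0, symmetric] by (intro integral_nonneg_AE) (auto simp: xi_bounds)
  have "expectation (\<xi> 0) \<le> expectation (\<lambda>_. 1)"
    by (intro integral_mono) (auto simp: xi_bounds)
  thus "s \<le> 1" by (simp add: expectation_xi prob_space)
qed

lemma abs_centered_le: "\<bar>\<xi> n \<omega> - s\<bar> \<le> 1"
  using xi_bounds[of n \<omega>] s_bounds by auto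

lemma integrable_prod_xi [simp]: "integrable M (\<lambda>\<omega>. \<Prod>n\<in>S. \<xi> n \<omega>)"
proof (rule integrable_const_bound[of _ 1])
  show "AE \<omega> in M. norm (\<Prod>n\<in>S. \<xi> n \<omega>) \<le> 1"
    by (auto simp: abs_prod xi_bounds intro!: prod_le_1)
qed auto

lemma integrable_prod_one_plus [simp]: "integrable M (\<lambda>\<omega>. \<Prod>n<N. 1 + d n * \<xi> n \<omega>)"
  unfolding prod_add[OF finite_lessThan] by (simp add: prod.distrib)

text \<open>Expanding the product gives moments weighted by products of the \<open>d n\<close>; the
  weights are nonnegative, so each moment may be replaced by its bound and the expansion folded
  back.\<close>

lemma expectation_prod_one_plus:
  assumes "\<And>n. d n \<ge> 0"
  shows "expectation (\<lambda>\<omega>. \<Prod>n<(N::nat). 1 + d n * \<xi> n \<omega>) \<le> (\<Prod>n<N. 1 + d n * s)"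
proof -
  have "expectation (\<lambda>\<omega>. \<Prod>n<N. 1 + d n * \<xi> n \<omega>) =
      (\<Sum>S\<in>Pow {..<N}. prod d ({..<N} - S) * expectation (\<lambda>\<omega>. \<Prod>n\<in>{..<N} - S. \<xi> n \<omega>))"
    unfolding prod_add[OF finite_lessThan] by (simp add: prod.distrib)
  also have "\<dots> \<le> (\<Sum>S\<in>Pow {..<N}. prod d ({..<N} - S) * s ^ card ({..<N} - S))"
    using assms by (intro sum_mono mult_left_mono expectation_prod_xi prod_nonneg) auto
  also have "\<dots> = (\<Prod>n<N. 1 + d n * s)"
    unfolding prod_add[OF finite_lessThan] by (simp add: prod.distrib)
  finally show ?thesis .
qed

text \<open>On the two values 0 and 1 an exponential is an affine function; this turns exponential
  moments into the products bounded above.\<close>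

lemma exp_sum_xi: "exp (t * (\<Sum>n<(N::nat). a n * \<xi> n \<omega>)) = (\<Prod>n<N. 1 + (exp (t * a n) - 1) * \<xi> n \<omega>)"
proof -
  have "exp (t * a n * \<xi> n \<omega>) = 1 + (exp (t * a n) - 1) * \<xi> n \<omega>" for n
    using xi_cases[of n \<omega>] by auto
  thus ?thesis
    by (simp add: sum_distrib_left exp_sum mult.assoc)
qed

lemma exp_sum_centered:
  "exp (t * (\<Sum>n<(N::nat). a n * (\<xi> n \<omega> - s))) =
    exp (- (t * s * (\<Sum>n<N. a n))) * (\<Prod>n<N. 1 + (exp (t * a n) - 1) * \<xi> n \<omega>)"
proof -
  have "t * (\<Sum>n<N. a n * (\<xi> n \<omega> - s)) = - (t * s * (\<Sum>n<N. a n)) + t * (\<Sum>n<N. a n * \<xi> n \<omega>)"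
    by (simp add: right_diff_distrib sum_subtractf sum_distrib_left sum_distrib_right mult_ac)
  thus ?thesis by (simp only: exp_add exp_sum_xi)
qed

lemma integrable_exp_sum [simp]:
  "integrable M (\<lambda>\<omega>. exp (t * (\<Sum>n<(N::nat). a n * (\<xi> n \<omega> - s))))"
  unfolding exp_sum_centered by simp

text \<open>Chernoff estimate from \<open>exp x \<le> 1 + x + x\<^sup>2\<close> on the unit
  interval: the linear terms cancel against the centering and each index leaves at most
  \<open>t\<^sup>2\<close>. Nonnegativity of \<open>a\<close> makes the coefficients
  \<open>d n\<close> nonnegative.\<close>

lemma expectation_exp_le:
  assumes t: "0 \<le> t" "t \<le> 1" and a: "\<And>n. 0 \<le> a n" "\<And>n. a n \<le> 1"
  shows "expectation (\<lambda>\<omega>. exp (t * (\<Sum>n<N. a n * (\<xi> n \<omega> - s)))) \<le> exp (t\<^sup>2 * real N)"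
proof -
  define d where "d n = exp (t * a n) - 1" for n
  have d: "0 \<le> d n" "d n \<le> t * a n + t\<^sup>2" for n
  proof -
    have ta: "0 \<le> t * a n" "t * a n \<le> t" using t a[of n] by (auto intro: mult_left_le)
    thus "0 \<le> d n" by (simp add: d_def)
    have "exp (t * a n) \<le> 1 + t * a n + (t * a n)\<^sup>2" using ta t by (intro exp_bound) auto
    also have "(t * a n)\<^sup>2 \<le> t\<^sup>2" using ta by (intro power_mono) auto
    finally show "d n \<le> t * a n + t\<^sup>2" by (simp add: d_def)
  qed
  have "(\<Prod>n<N. 1 + d n * s) \<le> (\<Prod>n<N. exp (d n * s))"
    using d s_bounds by (intro prod_mono conjI) (auto intro: exp_ge_add_one_self)
  also have "\<dots> = exp (\<Sum>n<N. d n * s)" by (simp add: exp_sum)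
  also have "(\<Sum>n<N. d n * s) \<le> (\<Sum>n<N. t * s * a n + t\<^sup>2)"
  proof (rule sum_mono)
    fix n
    have "d n * s \<le> (t * a n + t\<^sup>2) * s" using d s_bounds by (intro mult_right_mono) auto
    also have "\<dots> \<le> t * s * a n + t\<^sup>2"
      using mult_left_le[of s "t\<^sup>2"] s_bounds by (simp add: algebra_simps)
    finally show "d n * s \<le> t * s * a n + t\<^sup>2" .
  qed
  also have "\<dots> = t * s * (\<Sum>n<N. a n) + t\<^sup>2 * real N"
    by (simp add: sum.distrib sum_distrib_left)
  finally have prod_le: "(\<Prod>n<N. 1 + d n * s) \<le> exp (t * s * (\<Sum>n<N. a n) + t\<^sup>2 * real N)" by simp
  have "expectation (\<lambda>\<omega>. exp (t * (\<Sum>n<N. a n * (\<xi> n \<omega> - s)))) =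
      exp (- (t * s * (\<Sum>n<N. a n))) * expectation (\<lambda>\<omega>. \<Prod>n<N. 1 + d n * \<xi> n \<omega>)"
    unfolding exp_sum_centered d_def by simp
  also have "\<dots> \<le> exp (- (t * s * (\<Sum>n<N. a n))) * exp (t * s * (\<Sum>n<N. a n) + t\<^sup>2 * real N)"
    using order.trans[OF expectation_prod_one_plus[OF d(1)] prod_le] by (intro mult_left_mono) auto
  also have "\<dots> = exp (t\<^sup>2 * real N)" by (simp add: exp_add[symmetric])
  finally show ?thesis .
qed

lemma prob_upper_tail:
  assumes t: "0 \<le> t" "t \<le> 1" and a: "\<And>n. 0 \<le> a n" "\<And>n. a n \<le> 1"
  shows "prob {\<omega>\<in>space M. (\<Sum>n<N. a n * (\<xi> n \<omega> - s)) \<ge> l} \<le> exp (t\<^sup>2 * real N - t * l)"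
proof -
  let ?X = "\<lambda>\<omega>. exp (t * (\<Sum>n<N. a n * (\<xi> n \<omega> - s)))"
  have "prob {\<omega>\<in>space M. (\<Sum>n<N. a n * (\<xi> n \<omega> - s)) \<ge> l} \<le> prob {\<omega>\<in>space M. ?X \<omega> \<ge> exp (t * l)}"
    using t by (intro finite_measure_mono) (auto intro: mult_left_mono)
  also have "\<dots> \<le> expectation ?X / exp (t * l)"
    by (rule integral_Markov_inequality_measure[where A = "space M"]) auto
  also have "\<dots> \<le> exp (t\<^sup>2 * real N) / exp (t * l)"
    by (intro divide_right_mono expectation_exp_le t a) auto
  finally show ?thesis by (simp add: exp_diff)
qed

section \<open>Variance of the sum of the centered variables\<close>

lemma expectation_centered_mult:
  assumes "i \<noteq> j"
  shows "expectation (\<lambda>\<omega>. (\<xi> i \<omega> - s) * (\<xi> j \<omega> - s)) \<le> 0"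
proof -
  have int: "integrable M (\<lambda>\<omega>. \<xi> i \<omega> * \<xi> j \<omega>)"
    using integrable_prod_xi[of "{i, j}"] assms by simp
  have "expectation (\<lambda>\<omega>. \<xi> i \<omega> * \<xi> j \<omega>) \<le> s\<^sup>2"
    using expectation_prod_xi[of "{i, j}"] assms by (simp add: power2_eq_square)
  moreover have "(\<lambda>\<omega>. (\<xi> i \<omega> - s) * (\<xi> j \<omega> - s)) = (\<lambda>\<omega>. \<xi> i \<omega> * \<xi> j \<omega> - s * \<xi> i \<omega> - s * \<xi> j \<omega> + s\<^sup>2)"
    by (auto simp: algebra_simps power2_eq_square)
  ultimately show ?thesis
    using int by (simp add: expectation_xi prob_space power2_eq_square)
qed

lemma integrable_centered_mult [simp]: "integrable M (\<lambda>\<omega>. (\<xi> i \<omega> - s) * (\<xi> j \<omega> - s))"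
proof (rule integrable_const_bound[of _ 1])
  show "AE \<omega> in M. norm ((\<xi> i \<omega> - s) * (\<xi> j \<omega> - s)) \<le> 1"
    using abs_centered_le by (auto simp: abs_mult intro!: mult_le_one)
qed auto

text \<open>The product bound for pairs makes all covariances nonpositive, so only the
  \<open>N\<close> diagonal terms count, each at most 1.\<close>

lemma expectation_sum_centered_square: "expectation (\<lambda>\<omega>. (\<Sum>n<N. \<xi> n \<omega> - s)\<^sup>2) \<le> real N"
proof -
  have "expectation (\<lambda>\<omega>. (\<Sum>n<N. \<xi> n \<omega> - s)\<^sup>2) =
      (\<Sum>i<N. \<Sum>j<N. expectation (\<lambda>\<omega>. (\<xi> i \<omega> - s) * (\<xi> j \<omega> - s)))"
    by (simp add: power2_eq_square sum_product)
  also have "\<dots> \<le> (\<Sum>i<N. \<Sum>j<N. if i = j then 1 else 0)"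
  proof (intro sum_mono)
    fix i j
    have "expectation (\<lambda>\<omega>. (\<xi> i \<omega> - s) * (\<xi> i \<omega> - s)) \<le> expectation (\<lambda>\<omega>. 1)"
      using abs_centered_le[of i]
      by (intro integral_mono integrable_centered_mult)
        (auto simp: power2_eq_square[symmetric] abs_square_le_1)
    thus "expectation (\<lambda>\<omega>. (\<xi> i \<omega> - s) * (\<xi> j \<omega> - s)) \<le> (if i = j then 1 else 0)"
      using expectation_centered_mult[of i j] by (auto simp: prob_space)
  qed
  also have "\<dots> = real N" by simp
  finally show ?thesis .
qed

lemma prob_sum_ge:
  assumes "l > 0"
  shows "prob {\<omega>\<in>space M. \<bar>\<Sum>n<N. \<xi> n \<omega> - s\<bar> \<ge> l} \<le> real N / l\<^sup>2"
proof -
  let ?X = "\<lambda>\<omega>. (\<Sum>n<N. \<xi> n \<omega> - s)\<^sup>2"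
  have "l\<^sup>2 \<le> x\<^sup>2 \<longleftrightarrow> l \<le> \<bar>x\<bar>" for x using assms abs_le_square_iff[of l x] by simp
  hence "prob {\<omega>\<in>space M. \<bar>\<Sum>n<N. \<xi> n \<omega> - s\<bar> \<ge> l} = prob {\<omega>\<in>space M. ?X \<omega> \<ge> l\<^sup>2}" by simp
  also have "\<dots> \<le> expectation ?X / l\<^sup>2"
  proof (rule integral_Markov_inequality_measure[where A = "space M"])
    show "integrable M ?X" by (simp add: power2_eq_square sum_product)
  qed (use assms in auto)
  also have "\<dots> \<le> real N / l\<^sup>2"
    by (intro divide_right_mono expectation_sum_centered_square) auto
  finally show ?thesis .
qed

text \<open>Borel-Cantelli with a threshold of order \<open>N\<close> to the power 3/4: each upper
  tail is exponentially small in \<open>k\<close>, which beats the polynomial number of test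
  sequences, and the plain sum of the centered variables adds one event of probability at most
  \<open>1 / k\<^sup>2\<close>.\<close>

lemma AE_test_sums:
  assumes c: "c \<ge> 1"
    and fin: "\<And>k. finite (A k)" and card: "\<And>k. k \<ge> 1 \<Longrightarrow> real (card (A k)) \<le> C * real k ^ m"
    and A: "\<And>k a n. a \<in> A k \<Longrightarrow> \<bar>a n\<bar> \<le> 1"
  shows "AE \<omega> in M. eventually (\<lambda>k. \<forall>a\<in>A k. \<bar>\<Sum>n<k ^ (4 * c). a n * (\<xi> n \<omega> - s)\<bar> \<le> 3 * real k ^ (3 * c)) sequentially"
proof -
  define N where "N k = k ^ (4 * c)" for k :: nat
  define l where "l k = real k ^ (3 * c)" for k :: nat
  define U where "U k b = {\<omega>\<in>space M. (\<Sum>n<N k. b n * (\<xi> n \<omega> - s)) \<ge> l k}" for k b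
  define V where "V k = {\<omega>\<in>space M. \<bar>\<Sum>n<N k. \<xi> n \<omega> - s\<bar> \<ge> l k}" for k
  \<comment> \<open>Products of the \<open>\<xi> n\<close> only control upper tails. The lower tail of a test sum is the upper tail for
    \<open>q\<close> combined with the sum of the \<open>\<xi> n\<close> themselves, for which the variance suffices.\<close>
  define p where "p b n = (1 + b n) / 2" for b :: "nat \<Rightarrow> real" and n
  define q where "q b n = (1 - b n) / 2" for b :: "nat \<Rightarrow> real" and n
  define B where "B k = V k \<union> (\<Union>a\<in>A k. U k (p a) \<union> U k (q a))" for k
  have [measurable]: "U k b \<in> sets M" "V k \<in> sets M" for k b unfolding U_def V_def by measurable
  have [measurable]: "B k \<in> sets M" for k unfolding B_def using fin[of k] by (intro sets.Un sets.finite_UN) auto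
  have UB: "prob (U k b) \<le> exp (1 - real k)" if "k \<ge> 1" "\<And>n. 0 \<le> b n" "\<And>n. b n \<le> 1" for k b
  proof -
    \<comment> \<open>This is \<open>N k\<close> to the power -1/2: then
      \<open>t\<^sup>2 * N k\<close> is 1, while \<open>t * l k\<close> still grows like
      \<open>k ^ c\<close>.\<close>
    define t where "t = 1 / real k ^ (2 * c)"
    have "prob (U k b) \<le> exp (t\<^sup>2 * real (N k) - t * l k)"
      unfolding U_def using that by (intro prob_upper_tail) (auto simp: t_def one_le_power)
    also have "t\<^sup>2 * real (N k) = 1"
      using that(1) by (simp add: t_def N_def power_divide power_mult[symmetric])
    also have "t * l k = real k ^ c"
      using that(1) power_add[of "real k" c "2 * c"] by (simp add: t_def l_def)
    also have "exp (1 - real k ^ c) \<le> exp (1 - real k)"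
      using power_increasing[of 1 c "real k"] c that(1) by simp
    finally show ?thesis .
  qed
  have VB: "prob (V k) \<le> 1 / real k ^ 2" if "k \<ge> 1" for k
  proof -
    have "prob (V k) \<le> real (N k) / (l k)\<^sup>2"
      unfolding V_def using that by (intro prob_sum_ge) (simp add: l_def)
    also have "\<dots> = 1 / real k ^ (2 * c)"
      using that power_add[of "real k" "4 * c" "2 * c"]
      by (simp add: N_def l_def power_mult[symmetric] mult.commute)
    also have "\<dots> \<le> 1 / real k ^ 2"
      using that c by (intro divide_left_mono power_increasing) auto
    finally show ?thesis .
  qed
  have BB: "prob (B k) \<le> 1 / real k ^ 2 + 2 * C * exp 1 * (real k ^ m / exp (real k))" if "k \<ge> 1" for k
  proof -
    have "prob (B k) \<le> prob (V k) + prob (\<Union>a\<in>A k. U k (p a) \<union> U k (q a))"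
      unfolding B_def using fin[of k] by (intro measure_Un_le sets.finite_UN) auto
    also have "prob (\<Union>a\<in>A k. U k (p a) \<union> U k (q a)) \<le> (\<Sum>a\<in>A k. prob (U k (p a) \<union> U k (q a)))"
      using fin[of k] by (intro finite_measure_subadditive_finite) auto
    also have "\<dots> \<le> (\<Sum>a\<in>A k. exp (1 - real k) + exp (1 - real k))"
    proof (rule sum_mono)
      fix a assume a: "a \<in> A k"
      have "0 \<le> p a n" "p a n \<le> 1" "0 \<le> q a n" "q a n \<le> 1" for n
        using A[OF a, of n] by (auto simp: p_def q_def)
      hence "prob (U k (p a)) + prob (U k (q a)) \<le> exp (1 - real k) + exp (1 - real k)"
        using that by (intro add_mono UB) auto
      moreover have "prob (U k (p a) \<union> U k (q a)) \<le> prob (U k (p a)) + prob (U k (q a))"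
        by (intro measure_Un_le) auto
      ultimately show "prob (U k (p a) \<union> U k (q a)) \<le> exp (1 - real k) + exp (1 - real k)" by linarith
    qed
    also have "\<dots> = real (card (A k)) * (2 * exp 1 / exp (real k))"
      by (simp add: exp_diff)
    also have "\<dots> \<le> (C * real k ^ m) * (2 * exp 1 / exp (real k))"
      by (intro mult_right_mono card that) auto
    finally show ?thesis using VB[OF that] by (simp add: mult_ac)
  qed
  have "((\<lambda>x. x ^ (m + 2) / exp x) \<longlongrightarrow> 0) (at_top :: real filter)"
    by (rule tendsto_power_div_exp_0)
  hence "((\<lambda>k. real k ^ (m + 2) / exp (real k)) \<longlonglongrightarrow> 0)"
    by (rule filterlim_compose[OF _ filterlim_real_sequentially])
  hence "eventually (\<lambda>k. real k ^ (m + 2) / exp (real k) < 1) sequentially"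
    by (rule order_tendstoD) auto
  hence ev: "eventually (\<lambda>k. real k ^ m / exp (real k) \<le> 1 / real k ^ 2) sequentially"
    using eventually_gt_at_top[of 0] by eventually_elim (auto simp: field_simps power_add power2_eq_square)
  have sq: "summable (\<lambda>k. 1 / real k ^ 2)"
    using inverse_power_summable[of 2, where 'a = real] by (simp add: inverse_eq_divide)
  have "summable (\<lambda>k. real k ^ m / exp (real k))"
    by (rule summable_comparison_test_ev[OF _ sq]) (use ev in eventually_elim, auto)
  hence "summable (\<lambda>k. 1 / real k ^ 2 + 2 * C * exp 1 * (real k ^ m / exp (real k)))"
    by (intro summable_add summable_mult sq)
  hence "summable (\<lambda>k. prob (B k))"
    by (rule summable_comparison_test_ev[rotated])
       (use eventually_ge_at_top[of 1] in eventually_elim, use BB in auto)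
  hence "AE \<omega> in M. eventually (\<lambda>k. \<omega> \<in> space M - B k) sequentially"
    by (intro borel_cantelli_AE1) (auto simp: emeasure_eq_measure)
  thus ?thesis
  proof (rule AE_mp, intro AE_I2 impI)
    fix \<omega> assume \<omega>: "\<omega> \<in> space M" and "eventually (\<lambda>k. \<omega> \<in> space M - B k) sequentially"
    from this(2) show "eventually (\<lambda>k. \<forall>a\<in>A k. \<bar>\<Sum>n<k ^ (4 * c). a n * (\<xi> n \<omega> - s)\<bar> \<le> 3 * real k ^ (3 * c)) sequentially"
    proof eventually_elim
      case (elim k)
      show ?case
      proof
        fix a assume a: "a \<in> A k"
        define S where "S b = (\<Sum>n<N k. b n * (\<xi> n \<omega> - s))" for b
        define W where "W = (\<Sum>n<N k. \<xi> n \<omega> - s)"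
        have "S (p a) < l k" "S (q a) < l k" "\<bar>W\<bar> < l k"
          using elim a \<omega> by (auto simp: B_def U_def V_def S_def W_def not_le)
        \<comment> \<open>Hence \<open>S a = 2 * S (p a) - W\<close> and
          \<open>- S a = 2 * S (q a) - W\<close>, which is where the factor 3 comes from.\<close>
        moreover have "S (p a) = (W + S a) / 2" "S (q a) = (W - S a) / 2"
          by (simp_all add: S_def W_def p_def q_def sum_divide_distrib add_divide_distrib
            diff_divide_distrib algebra_simps flip: sum.distrib sum_subtractf)
        ultimately have "S a \<le> 3 * l k" "- S a \<le> 3 * l k"
          by (simp_all add: abs_less_iff field_simps)
        hence "\<bar>S a\<bar> \<le> 3 * l k" by (rule abs_leI)
        thus "\<bar>\<Sum>n<k ^ (4 * c). a n * (\<xi> n \<omega> - s)\<bar> \<le> 3 * real k ^ (3 * c)"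
          by (simp add: S_def N_def l_def)
      qed
    qed
  qed
qed

end

section \<open>Transference\<close>

lemma cis_frac_mod:
  assumes "M > 0" "k mod int M = l mod int M"
  shows "cis (2 * pi * of_int k / of_nat M) = cis (2 * pi * of_int l / of_nat M)"
proof -
  obtain q where q: "k = l + int M * q"
    using assms(2) by (metis mod_eqE add.commute diff_add_cancel mult.commute)
  have "2 * pi * of_int k / of_nat M = 2 * pi * of_int l / of_nat M + 2 * pi * real_of_int q"
    using assms(1) by (simp add: q field_simps)
  thus ?thesis by (simp add: cis_mult[symmetric])
qed

text \<open>Orthogonality of characters: a geometric sum over powers of an \<open>M\<close>-th root
  of unity.\<close>

lemma sum_cis_frac:
  assumes "M > 0"
  shows "(\<Sum>j<M. cis (2 * pi * of_int (int j * k) / of_nat M)) = (if int M dvd k then of_nat M else 0)"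
proof -
  let ?z = "cis (2 * pi * of_int k / of_nat M)"
  have pow: "cis (2 * pi * of_int (int j * k) / of_nat M) = ?z ^ j" for j
    unfolding Complex.DeMoivre by (rule arg_cong[where f = cis]) simp
  have "?z = 1 \<longleftrightarrow> (\<exists>n::int. real_of_int k = of_int n * of_nat M)"
    using assms by (simp add: cis_eq_1_iff field_simps)
  also have "\<dots> \<longleftrightarrow> (\<exists>n::int. k = n * int M)"
    by (metis of_int_eq_iff of_int_mult of_int_of_nat_eq)
  also have "\<dots> \<longleftrightarrow> int M dvd k" by (auto simp: dvd_def mult.commute)
  finally have one: "?z = 1 \<longleftrightarrow> int M dvd k" .
  show ?thesis
  proof (cases "int M dvd k")
    case True
    thus ?thesis using one unfolding pow by simp
  next
    case False
    have "?z ^ M = cis (2 * pi * of_int k)" using assms by (simp add: Complex.DeMoivre)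
    also have "\<dots> = 1" by simp
    finally show ?thesis using False one unfolding pow by (simp add: geometric_sum)
  qed
qed

lemma discrete_Parseval:
  assumes "M > 0"
  shows "(\<Sum>j<M. (norm (\<Sum>l<M. b l * cis (2 * pi * of_int (int j * int l) / of_nat M)))\<^sup>2) =
    real M * (\<Sum>l<M. (norm (b l))\<^sup>2)"
proof -
  define e where "e k = cis (2 * pi * of_int k / of_nat M)" for k :: int
  have e: "e k * cnj (e l) = e (k - l)" for k l
    by (simp add: e_def cis_cnj cis_mult diff_divide_distrib algebra_simps)
  have dvd: "int M dvd int l - int m \<longleftrightarrow> l = m" if "l < M" "m < M" for l m
    using that by (metis int_ops(9) mod_eq_dvd_iff mod_less of_nat_eq_iff)
  have "complex_of_real (\<Sum>j<M. (norm (\<Sum>l<M. b l * e (int j * int l)))\<^sup>2) =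
      (\<Sum>j<M. (\<Sum>l<M. b l * e (int j * int l)) * cnj (\<Sum>m<M. b m * e (int j * int m)))"
    by (simp only: of_real_sum complex_norm_square)
  also have "\<dots> = (\<Sum>j<M. \<Sum>l<M. \<Sum>m<M. b l * cnj (b m) * e (int j * (int l - int m)))"
    unfolding cnj_sum sum_product
    by (intro sum.cong refl) (simp add: right_diff_distrib flip: e)
  also have "\<dots> = (\<Sum>l<M. \<Sum>j<M. \<Sum>m<M. b l * cnj (b m) * e (int j * (int l - int m)))"
    by (rule sum.swap)
  also have "\<dots> = (\<Sum>l<M. \<Sum>m<M. \<Sum>j<M. b l * cnj (b m) * e (int j * (int l - int m)))"
    by (rule sum.cong[OF refl sum.swap])
  also have "\<dots> = (\<Sum>l<M. \<Sum>m<M. b l * cnj (b m) * (if l = m then of_nat M else 0))"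
    unfolding sum_distrib_left[symmetric] e_def sum_cis_frac[OF assms]
    by (intro sum.cong refl) (simp add: dvd)
  also have "\<dots> = (\<Sum>l<M. b l * cnj (b l) * of_nat M)"
    by (intro sum.cong refl) (simp add: if_distrib cong: if_cong)
  also have "\<dots> = complex_of_real (real M * (\<Sum>l<M. (norm (b l))\<^sup>2))"
    by (simp only: of_real_mult of_real_sum complex_norm_square of_real_of_nat_eq sum_distrib_left mult.commute)
  finally show ?thesis unfolding of_real_eq_iff e_def .
qed

lemma bij_betw_add_mod:
  assumes "M > (0::nat)"
  shows "bij_betw (\<lambda>l. (p + l) mod M) {..<M} {..<M}"
proof -
  have "inj_on (\<lambda>l. (p + l) mod M) {..<M}"
  proof (rule inj_onI)
    fix x y assume "x \<in> {..<M}" "y \<in> {..<M}" "(p + x) mod M = (p + y) mod M"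
    thus "x = y"
      by (simp add: cong_add_lcancel_nat flip: cong_def) (simp add: cong_def)
  qed
  thus ?thesis
    using assms by (intro bij_betw_imageI card_subset_eq) (auto simp: card_image)
qed

text \<open>The operator is a convolution on the cyclic group, diagonalized by the discrete Fourier
  transform with multiplier \<open>Q\<close>; Parseval on both sides turns a uniform bound on
  \<open>Q\<close> into a bound of the operator norm.\<close>

lemma cyclic_convolution_bound:
  fixes w :: "nat \<Rightarrow> real" and a :: "nat \<Rightarrow> complex" and p :: "nat \<Rightarrow> nat"
  assumes M: "M > 0" and B: "B \<ge> 0"
    and bound: "\<And>j. j < M \<Longrightarrow> norm (\<Sum>n<N. of_real (w n) * cis (2 * pi * of_int (int j * int (p n)) / of_nat M)) \<le> B"
  shows "(\<Sum>l<M. (norm (\<Sum>n<N. of_real (w n) * a ((p n + l) mod M)))\<^sup>2) \<le> B\<^sup>2 * (\<Sum>l<M. (norm (a l))\<^sup>2)"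
proof -
  define e where "e k = cis (2 * pi * of_int k / of_nat M)" for k :: int
  have e_add: "e (k + l) = e k * e l" for k l
    by (simp add: e_def cis_mult add_divide_distrib algebra_simps)
  have e_uminus: "e (- k) = cnj (e k)" for k by (simp add: e_def cis_cnj)
  define Q where "Q j = (\<Sum>n<N. of_real (w n) * e (- (int j * int (p n))))" for j
  define A where "A j = (\<Sum>l<M. a l * e (int j * int l))" for j
  have Q: "norm (Q j) \<le> B" if "j < M" for j
  proof -
    \<comment> \<open>The weights are real, so conjugation flips the sign of the frequency and
      \<open>bound\<close> applies at \<open>j\<close> itself.\<close>
    have "Q j = cnj (\<Sum>n<N. of_real (w n) * e (int j * int (p n)))"
      by (simp add: Q_def e_uminus)
    thus ?thesis using bound[OF that] by (simp only: complex_mod_cnj e_def)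
  qed
  have conv: "(\<Sum>l<M. (\<Sum>n<N. of_real (w n) * a ((p n + l) mod M)) * e (int j * int l)) = Q j * A j" for j
  proof -
    have shift: "(\<Sum>l<M. a ((p + l) mod M) * e (int j * int l)) = e (- (int j * int p)) * A j" for p
    proof -
      have "e (int j * int l) = e (- (int j * int p)) * e (int j * int ((p + l) mod M))" for l
      proof -
        have "e (int j * int l) = e (- (int j * int p) + int j * int ((p + l) mod M))"
          unfolding e_def
        proof (rule cis_frac_mod[OF M])
          show "int j * int l mod int M = (- (int j * int p) + int j * int ((p + l) mod M)) mod int M"
          proof -
            have "(int j * ((int p + int l) mod int M) - int j * int p) mod int M =
                (int j * (int p + int l) - int j * int p) mod int M"
              by (metis mod_diff_left_eq mod_mult_right_eq)
            thus ?thesis by (simp add: zmod_int distrib_left)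
          qed
        qed
        thus ?thesis by (simp only: e_add)
      qed
      hence "(\<Sum>l<M. a ((p + l) mod M) * e (int j * int l)) =
          (\<Sum>l<M. e (- (int j * int p)) * (a ((p + l) mod M) * e (int j * int ((p + l) mod M))))"
        by (intro sum.cong refl) (simp add: mult_ac)
      also have "\<dots> = (\<Sum>u<M. e (- (int j * int p)) * (a u * e (int j * int u)))"
        by (rule sum.reindex_bij_betw[OF bij_betw_add_mod[OF M]])
      finally show ?thesis by (simp add: A_def sum_distrib_left)
    qed
    have "(\<Sum>l<M. (\<Sum>n<N. of_real (w n) * a ((p n + l) mod M)) * e (int j * int l)) =
        (\<Sum>n<N. of_real (w n) * (\<Sum>l<M. a ((p n + l) mod M) * e (int j * int l)))"
      unfolding sum_distrib_left sum_distrib_right by (subst sum.swap) (simp add: mult_ac)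
    thus ?thesis
      unfolding shift by (simp add: Q_def sum_distrib_right mult.assoc)
  qed
  have "real M * (\<Sum>l<M. (norm (\<Sum>n<N. of_real (w n) * a ((p n + l) mod M)))\<^sup>2) = (\<Sum>j<M. (norm (Q j * A j))\<^sup>2)"
    unfolding discrete_Parseval[OF M, symmetric] conv[symmetric] e_def ..
  also have "\<dots> \<le> (\<Sum>j<M. B\<^sup>2 * (norm (A j))\<^sup>2)"
    using Q B by (intro sum_mono) (auto simp: norm_mult power_mult_distrib intro!: mult_right_mono power_mono)
  also have "\<dots> = real M * (B\<^sup>2 * (\<Sum>l<M. (norm (a l))\<^sup>2))"
    unfolding A_def e_def sum_distrib_left[symmetric] discrete_Parseval[OF M] by simp
  finally show ?thesis using M by simp
qed

text \<open>Jensen's inequality for a convex power, applied to the positive terms only; raising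
  their number back to \<open>card I\<close> is harmless because \<open>r - 1\<close> is
  nonnegative.\<close>

lemma powr_sum_le:
  fixes x :: "'i \<Rightarrow> real"
  assumes "finite I" "\<And>i. i \<in> I \<Longrightarrow> 0 \<le> x i" "r \<ge> 1"
  shows "(\<Sum>i\<in>I. x i) powr r \<le> real (card I) powr (r - 1) * (\<Sum>i\<in>I. x i powr r)"
proof -
  define J where "J = {i\<in>I. x i > 0}"
  have J: "finite J" "J \<subseteq> I" using assms by (auto simp: J_def)
  have sums: "(\<Sum>i\<in>I. x i) = (\<Sum>i\<in>J. x i)" "(\<Sum>i\<in>I. x i powr r) = (\<Sum>i\<in>J. x i powr r)"
    using assms by (auto simp: J_def intro!: sum.mono_neutral_right) (metis less_le)+
  show ?thesis
  proof (cases "J = {}")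
    case True
    thus ?thesis unfolding sums by simp
  next
    case False
    define m where "m = real (card J)"
    have m: "m > 0" using False J by (simp add: m_def card_gt_0_iff)
    have "(\<Sum>i\<in>J. (1 / m) *\<^sub>R x i) powr r \<le> (\<Sum>i\<in>J. (1 / m) * x i powr r)"
      using m J False assms(3)
      by (intro convex_on_sum[OF _ _ powr_convex]) (auto simp: J_def m_def)
    hence "((\<Sum>i\<in>J. x i) / m) powr r \<le> (\<Sum>i\<in>J. x i powr r) / m"
      by (simp add: sum_divide_distrib)
    hence "(\<Sum>i\<in>J. x i) powr r \<le> m powr r / m * (\<Sum>i\<in>J. x i powr r)"
      using m by (simp add: powr_divide sum_nonneg J_def field_simps)
    also have "m powr r / m = m powr (r - 1)"
      using m by (simp add: powr_diff)
    also have "m powr (r - 1) * (\<Sum>i\<in>J. x i powr r) \<le> real (card I) powr (r - 1) * (\<Sum>i\<in>J. x i powr r)"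
      using assms J by (intro mult_right_mono powr_mono2 sum_nonneg) (auto simp: m_def card_mono)
    finally show ?thesis unfolding sums .
  qed
qed

text \<open>By monotone convergence the sum of all \<open>X k\<close> has a finite integral, hence
  is finite almost everywhere, and there its terms tend to 0.\<close>

lemma AE_tendsto_zero_of_summable:
  fixes X :: "nat \<Rightarrow> 'x \<Rightarrow> real"
  assumes int: "\<And>k. integrable M (X k)" and nonneg: "\<And>k x. 0 \<le> X k x"
    and sum: "summable (\<lambda>k. LINT x|M. X k x)"
  shows "AE x in M. (\<lambda>k. X k x) \<longlonglongrightarrow> 0"
proof -
  have [measurable]: "X k \<in> borel_measurable M" for k using int by auto
  have "(\<integral>\<^sup>+x. (\<Sum>k. ennreal (X k x)) \<partial>M) = (\<Sum>k. \<integral>\<^sup>+x. ennreal (X k x) \<partial>M)"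
    by (rule nn_integral_suminf) auto
  also have "\<dots> = (\<Sum>k. ennreal (LINT x|M. X k x))"
    using int nonneg by (simp add: nn_integral_eq_integral)
  also have "\<dots> = ennreal (\<Sum>k. LINT x|M. X k x)"
    using sum nonneg by (intro suminf_ennreal2) (auto intro!: integral_nonneg_AE)
  finally have "(\<integral>\<^sup>+x. (\<Sum>k. ennreal (X k x)) \<partial>M) \<noteq> \<infinity>" by simp
  hence "AE x in M. (\<Sum>k. ennreal (X k x)) \<noteq> \<infinity>"
    by (intro nn_integral_PInf_AE) auto
  thus ?thesis
    by (rule AE_mp, intro AE_I2 impI summable_LIMSEQ_zero summable_suminf_not_top) (auto simp: nonneg)
qed

section \<open>Weighted sums along orbits of a measure-preserving map\<close>

lemma mp_system_funpow:
  assumes "mp_system M T"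
  shows "mp_system M (T ^^ n)"
proof (induction n)
  case 0
  show ?case using assms by (simp add: mp_system_def id_def distr_id)
next
  case (Suc n)
  have [measurable]: "T \<in> M \<rightarrow>\<^sub>M M" "T ^^ n \<in> M \<rightarrow>\<^sub>M M"
    using assms Suc by (auto simp: mp_system_def)
  have "distr M M (T \<circ> T ^^ n) = distr (distr M M (T ^^ n)) M T"
    by (rule distr_distr[symmetric]) measurable
  thus ?case using assms Suc by (simp add: mp_system_def comp_def)
qed

locale mp_weighted =
  fixes M :: "'x measure" and T :: "'x \<Rightarrow> 'x" and p :: "nat \<Rightarrow> nat" and w :: "nat \<Rightarrow> real"
  assumes mp: "mp_system M T" and w_le: "\<bar>w n\<bar> \<le> 1"
begin

sublocale prob_space M using mp by (simp add: mp_system_def)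

lemma measurable_funpow [measurable]: "T ^^ n \<in> M \<rightarrow>\<^sub>M M"
  using mp_system_funpow[OF mp, of n] by (simp add: mp_system_def)

lemma integral_funpow:
  fixes h :: "'x \<Rightarrow> real"
  assumes "h \<in> borel_measurable M"
  shows "(LINT x|M. h ((T ^^ n) x)) = (LINT x|M. h x)"
  using integral_distr[OF measurable_funpow assms, of n] mp_system_funpow[OF mp, of n]
  by (simp add: mp_system_def)

lemma integrable_funpow:
  fixes h :: "'x \<Rightarrow> real"
  assumes "integrable M h"
  shows "integrable M (\<lambda>x. h ((T ^^ n) x))"
  using integrable_distr[OF measurable_funpow, of n h] assms mp_system_funpow[OF mp, of n]
  by (simp add: mp_system_def)

text \<open>Not normalized and over any index set, so that initial segments and the pieces left over
  between two lengths are treated alike.\<close>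

definition wsum :: "nat set \<Rightarrow> ('x \<Rightarrow> complex) \<Rightarrow> 'x \<Rightarrow> complex" where
  "wsum I g x = (\<Sum>n\<in>I. of_real (w n) * g ((T ^^ p n) x))"

lemma measurable_wsum [measurable]: "g \<in> borel_measurable M \<Longrightarrow> wsum I g \<in> borel_measurable M"
  unfolding wsum_def
  by (intro borel_measurable_sum borel_measurable_times borel_measurable_const
      measurable_compose[OF measurable_funpow])

lemma norm_wsum_le: "norm (wsum I g x) \<le> (\<Sum>n\<in>I. norm (g ((T ^^ p n) x)))"
  unfolding wsum_def
  by (rule order.trans[OF norm_sum sum_mono]) (auto simp: norm_mult intro: mult_left_le_one_le w_le)

text \<open>The triangle inequality in L^r raised to the power \<open>r\<close>, from power means
  and invariance of the measure. With absolute values inside, the sum is monotone in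
  \<open>I\<close>, so a whole gap dominates each part of it.\<close>

lemma abs_sum_powr:
  assumes g: "g \<in> Lspace M r" and r: "r \<ge> 1" and I: "finite I"
  shows "integrable M (\<lambda>x. (\<Sum>n\<in>I. norm (g ((T ^^ p n) x))) powr r)" (is "integrable M ?F")
    and "(LINT x|M. (\<Sum>n\<in>I. norm (g ((T ^^ p n) x))) powr r)
      \<le> real (card I) powr r * (LINT x|M. norm (g x) powr r)" (is "_ \<le> ?B")
proof -
  have [measurable]: "g \<in> borel_measurable M" and int: "integrable M (\<lambda>x. norm (g x) powr r)"
    using g by (auto simp: Lspace_def)
  let ?G = "\<lambda>x. real (card I) powr (r - 1) * (\<Sum>n\<in>I. norm (g ((T ^^ p n) x)) powr r)"
  have le: "?F x \<le> ?G x" for x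
    by (rule powr_sum_le) (use I r in auto)
  have intG: "integrable M ?G"
    using integrable_funpow[OF int] by simp
  show intF: "integrable M ?F"
    by (rule Bochner_Integration.integrable_bound[OF intG])
       (auto simp: le sum_nonneg intro!: order.trans[OF le abs_ge_self])
  have "(LINT x|M. ?F x) \<le> (LINT x|M. ?G x)"
    using intF intG le by (intro integral_mono)
  also have "\<dots> = real (card I) powr (r - 1) * (\<Sum>n\<in>I. LINT x|M. norm (g x) powr r)"
    using integrable_funpow[OF int] integral_funpow[of "\<lambda>x. norm (g x) powr r"] by simp
  also have "\<dots> = ?B"
  proof (cases "I = {}")
    case False
    hence "real (card I) powr (r - 1) * real (card I) = real (card I) powr r"
      using I by (simp add: powr_diff card_gt_0_iff)
    thus ?thesis by (simp add: mult.assoc[symmetric])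
  qed (use r in auto)
  finally show "(LINT x|M. ?F x) \<le> ?B" .
qed

lemma wsum_powr:
  assumes g: "g \<in> Lspace M r" and r: "r \<ge> 1" and I: "finite I"
  shows "wsum I g \<in> Lspace M r"
    and "(LINT x|M. norm (wsum I g x) powr r) \<le> real (card I) powr r * (LINT x|M. norm (g x) powr r)"
proof -
  have [measurable]: "g \<in> borel_measurable M" using g by (auto simp: Lspace_def)
  note F = abs_sum_powr[OF assms]
  have le: "norm (wsum I g x) powr r \<le> (\<Sum>n\<in>I. norm (g ((T ^^ p n) x))) powr r" for x
    using r norm_wsum_le by (intro powr_mono2) auto
  have int: "integrable M (\<lambda>x. norm (wsum I g x) powr r)"
    by (rule Bochner_Integration.integrable_bound[OF F(1)]) (auto simp: le)
  thus "wsum I g \<in> Lspace M r" by (auto simp: Lspace_def)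
  have "(LINT x|M. norm (wsum I g x) powr r) \<le> (LINT x|M. (\<Sum>n\<in>I. norm (g ((T ^^ p n) x))) powr r)"
    using int F(1) le by (rule integral_mono)
  thus "(LINT x|M. norm (wsum I g x) powr r) \<le> real (card I) powr r * (LINT x|M. norm (g x) powr r)"
    using F(2) by linarith
qed

text \<open>Calderon's transference: along an orbit segment of length \<open>2 * D + 1\<close> the operator acts as a
  convolution on \<open>\<int>/(2 * D + 1)\<close>, and no index wraps around for the first \<open>D + 1\<close> points.\<close>

lemma transference:
  assumes g: "g \<in> Lspace M 2" and D: "\<And>n. n < N \<Longrightarrow> p n \<le> D" and B: "B \<ge> 0"
    and bound: "\<And>j. j < 2 * D + 1 \<Longrightarrow>
      norm (\<Sum>n<N. of_real (w n) * cis (2 * pi * of_int (int j * int (p n)) / of_nat (2 * D + 1))) \<le> B"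
  shows "(LINT x|M. (norm (wsum {..<N} g x))\<^sup>2) \<le> 2 * B\<^sup>2 * (LINT x|M. (norm (g x))\<^sup>2)"
proof -
  define K where "K = 2 * D + 1"
  let ?F = "\<lambda>x. (norm (wsum {..<N} g x))\<^sup>2" and ?g = "\<lambda>x. (norm (g x))\<^sup>2"
  have [measurable]: "g \<in> borel_measurable M" and intg: "integrable M ?g"
    using g by (auto simp: Lspace_def)
  have intF: "integrable M ?F"
    using wsum_powr(1)[OF g, of "{..<N}"] by (auto simp: Lspace_def)
  have le: "(\<Sum>l<D+1. ?F ((T ^^ l) x)) \<le> B\<^sup>2 * (\<Sum>u<K. ?g ((T ^^ u) x))" for x
  proof -
    define a where "a u = g ((T ^^ u) x)" for u
    have "?F ((T ^^ l) x) = (norm (\<Sum>n<N. of_real (w n) * a ((p n + l) mod K)))\<^sup>2" if "l < D + 1" for l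
    proof -
      have "(p n + l) mod K = p n + l" if "n < N" for n
        using D[OF that] \<open>l < D + 1\<close> by (simp add: K_def)
      thus ?thesis by (simp add: wsum_def a_def funpow_add)
    qed
    hence "(\<Sum>l<D+1. ?F ((T ^^ l) x)) = (\<Sum>l<D+1. (norm (\<Sum>n<N. of_real (w n) * a ((p n + l) mod K)))\<^sup>2)"
      by (intro sum.cong refl) auto
    \<comment> \<open>The remaining residues, where indices may wrap around, only add nonnegative
      terms.\<close>
    also have "\<dots> \<le> (\<Sum>l<K. (norm (\<Sum>n<N. of_real (w n) * a ((p n + l) mod K)))\<^sup>2)"
      by (rule sum_mono2) (auto simp: K_def)
    also have "\<dots> \<le> B\<^sup>2 * (\<Sum>u<K. (norm (a u))\<^sup>2)"
      using bound B by (intro cyclic_convolution_bound) (auto simp: K_def)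
    finally show ?thesis by (simp add: a_def)
  qed
  have "real (D + 1) * (LINT x|M. ?F x) = (\<Sum>l<D+1. LINT x|M. ?F ((T ^^ l) x))"
    by (subst integral_funpow) auto
  also have "\<dots> = (LINT x|M. (\<Sum>l<D+1. ?F ((T ^^ l) x)))"
    by (intro Bochner_Integration.integral_sum[symmetric] integrable_funpow[OF intF])
  also have "\<dots> \<le> (LINT x|M. B\<^sup>2 * (\<Sum>u<K. ?g ((T ^^ u) x)))"
    by (intro integral_mono le Bochner_Integration.integrable_sum integrable_mult_right
        integrable_funpow[OF intF] integrable_funpow[OF intg])
  also have "\<dots> = B\<^sup>2 * (\<Sum>u<K. LINT x|M. ?g ((T ^^ u) x))"
    by (subst integral_mult_right_zero, subst Bochner_Integration.integral_sum)
       (auto intro: integrable_funpow[OF intg])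
  also have "\<dots> = real K * (B\<^sup>2 * (LINT x|M. ?g x))"
    by (subst integral_funpow) auto
  \<comment> \<open>The cyclic group is less than twice as long as the usable segment; this ratio is
    the price of avoiding wrap-around.\<close>
  also have "\<dots> \<le> (2 * real (D + 1)) * (B\<^sup>2 * (LINT x|M. ?g x))"
    by (intro mult_right_mono mult_nonneg_nonneg integral_nonneg_AE) (auto simp: K_def)
  finally have "real (D + 1) * (LINT x|M. ?F x) \<le> real (D + 1) * (2 * B\<^sup>2 * (LINT x|M. ?g x))"
    by (simp only: mult_ac)
  thus ?thesis by (rule mult_left_le_imp_le) simp
qed

end

section \<open>Convergence of the averages\<close>

text \<open>Only the polynomially growing lengths \<open>N = k ^ (4 * c)\<close> are controlled; the bound is of order
  \<open>N powr (3/4)\<close>, and taking \<open>N\<close> to be a fourth power avoids real exponents. The moduli up to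
  \<open>k ^ (c * c)\<close> exceed any given power of \<open>N\<close> once \<open>c\<close> is large.\<close>

definition small_exponential_sums :: "(nat \<Rightarrow> real) \<Rightarrow> int poly \<Rightarrow> nat \<Rightarrow> bool" where
  "small_exponential_sums w P c \<longleftrightarrow>
     (\<forall>\<^sub>F k in sequentially. \<forall>K\<le>k ^ (c * c). \<forall>j<K.
        norm (\<Sum>n<k ^ (4 * c). of_real (w n) * cis (2 * pi * of_int (int j * poly P (int n)) / of_nat K))
          \<le> 6 * real k ^ (3 * c))"

section \<open>Elementary bounds for polynomials, powers and blocks of integers\<close>

lemma poly_int_bound: "\<exists>C::nat. \<forall>N. \<forall>n<N. \<bar>poly P (int n)\<bar> \<le> int C * int N ^ degree P"
proof (intro exI allI impI)
  fix N n :: nat assume n: "n < N"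
  have "\<bar>poly P (int n)\<bar> \<le> (\<Sum>i\<le>degree P. \<bar>coeff P i * int n ^ i\<bar>)"
    unfolding poly_altdef by (rule sum_abs)
  also have "\<dots> \<le> (\<Sum>i\<le>degree P. \<bar>coeff P i\<bar> * int N ^ degree P)"
  proof (intro sum_mono)
    fix i assume i: "i \<in> {..degree P}"
    have "int n ^ i \<le> int N ^ i" using n by (intro power_mono) auto
    also have "\<dots> \<le> int N ^ degree P" using n i by (intro power_increasing) auto
    finally show "\<bar>coeff P i * int n ^ i\<bar> \<le> \<bar>coeff P i\<bar> * int N ^ degree P"
      by (auto simp: abs_mult intro: mult_left_mono)
  qed
  also have "\<dots> = int (nat (\<Sum>i\<le>degree P. \<bar>coeff P i\<bar>)) * int N ^ degree P"
    by (simp add: sum_distrib_right sum_nonneg)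
  finally show "\<bar>poly P (int n)\<bar> \<le> int (nat (\<Sum>i\<le>degree P. \<bar>coeff P i\<bar>)) * int N ^ degree P" .
qed

text \<open>Convexity: the right side is the chord of the left side between \<open>x = 0\<close> and
  \<open>x = 1\<close>.\<close>

lemma one_plus_power_le:
  fixes x :: real
  assumes "0 \<le> x" "x \<le> 1"
  shows "(1 + x) ^ m \<le> 1 + (2 ^ m - 1) * x"
proof (induction m)
  case (Suc m)
  have "(1 + x) ^ Suc m \<le> (1 + x) * (1 + (2 ^ m - 1) * x)"
    using Suc assms by (auto intro: mult_left_mono)
  also have "\<dots> = 1 + 2 ^ m * x + (2 ^ m - 1) * (x * x)" by (simp add: algebra_simps)
  also have "(2 ^ m - 1) * (x * x) \<le> (2 ^ m - 1) * x"
    using assms by (intro mult_left_mono) (auto intro: mult_left_le)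
  finally show ?case by (simp add: algebra_simps)
qed simp

lemma power_gap_le:
  assumes "k \<ge> 1"
  shows "real (Suc k ^ m - k ^ m) / real (k ^ m) \<le> 2 ^ m / real k"
proof -
  have "real (Suc k ^ m - k ^ m) / real (k ^ m) = (1 + 1 / real k) ^ m - 1"
    using assms by (simp add: of_nat_diff power_mono divide_simps diff_divide_distrib power_divide
        flip: power_divide) (simp add: power_divide field_simps)
  also have "\<dots> \<le> (2 ^ m - 1) * (1 / real k)"
    using one_plus_power_le[of "1 / real k" m] assms by simp
  also have "\<dots> \<le> 2 ^ m / real k" using assms by (simp add: field_simps)
  finally show ?thesis .
qed

text \<open>Passes from the lengths \<open>k ^ m\<close> to all lengths: the blocks between
  consecutive powers cover every large \<open>N\<close>, with a block index as large as
  desired.\<close>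

lemma tendsto_zero_of_blocks:
  fixes b :: "nat \<Rightarrow> 'b :: real_normed_vector"
  assumes m: "m \<ge> 1" and le: "\<And>k N. k \<ge> 1 \<Longrightarrow> k ^ m \<le> N \<Longrightarrow> N < Suc k ^ m \<Longrightarrow> norm (b N) \<le> u k"
    and u: "u \<longlonglongrightarrow> 0"
  shows "b \<longlonglongrightarrow> 0"
proof (rule tendsto_norm_zero_cancel, rule LIMSEQ_I)
  fix e :: real assume "e > 0"
  then obtain K0 where K0: "\<And>k. k \<ge> K0 \<Longrightarrow> norm (u k - 0) < e"
    using LIMSEQ_D[OF u] by blast
  define K where "K = max K0 1"
  have block: "\<exists>k\<ge>K. k ^ m \<le> N \<and> N < Suc k ^ m" if "N \<ge> K ^ m" for N
    using that
  proof (induction N rule: dec_induct)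
    case base
    have "K ^ m < Suc K ^ m" using m by (intro power_strict_mono) auto
    thus ?case by blast
  next
    case (step N)
    then obtain k where k: "k \<ge> K" "k ^ m \<le> N" "N < Suc k ^ m" by blast
    show ?case
    proof (cases "Suc N < Suc k ^ m")
      case True
      thus ?thesis using k by (intro exI[of _ k]) auto
    next
      case False
      have "Suc k ^ m < Suc (Suc k) ^ m" using m by (intro power_strict_mono) auto
      thus ?thesis using k False by (intro exI[of _ "Suc k"]) auto
    qed
  qed
  show "\<exists>no. \<forall>n\<ge>no. norm (norm (b n) - 0) < e"
  proof (intro exI allI impI)
    fix N assume "N \<ge> K ^ m"
    from block[OF this] obtain k where k: "k \<ge> K" "k ^ m \<le> N" "N < Suc k ^ m" by blast
    hence "norm (b N) \<le> u k" by (intro le) (auto simp: K_def)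
    also have "\<dots> < e" using K0[of k] k by (auto simp: K_def)
    finally show "norm (norm (b N) - 0) < e" by simp
  qed
qed

lemma powr_add_le:
  fixes a b r :: real
  assumes "0 \<le> a" "0 \<le> b" "r \<ge> 1"
  shows "(a + b) powr r \<le> 2 powr (r - 1) * (a powr r + b powr r)"
  using powr_sum_le[of "UNIV :: bool set" "\<lambda>i. if i then a else b" r] assms
  by (simp add: UNIV_bool add.commute)

lemma tendsto_zero_powr_cancel:
  fixes X :: "nat \<Rightarrow> real"
  assumes "(\<lambda>k. X k powr r) \<longlonglongrightarrow> 0" "r > 0" "\<And>k. X k \<ge> 0"
  shows "X \<longlonglongrightarrow> 0"
proof -
  have "(\<lambda>k. (X k powr r) powr (1 / r)) \<longlonglongrightarrow> 0 powr (1 / r)"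
    using assms by (intro tendsto_powr') auto
  thus ?thesis using assms by (simp add: powr_powr)
qed

section \<open>Almost everywhere convergence of the averages\<close>

context mp_weighted
begin

lemma wsum_diff: "wsum I (\<lambda>x. g x - h x) x = wsum I g x - wsum I h x"
  by (simp add: wsum_def algebra_simps sum_subtractf)

lemma bounded_in_Lspace:
  assumes "g \<in> borel_measurable M" "\<And>x. norm (g x) \<le> H" "r \<ge> 0"
  shows "g \<in> Lspace M r"
proof -
  have "integrable M (\<lambda>x. norm (g x) powr r)"
    by (rule integrable_const_bound[of _ "H powr r"]) (use assms in \<open>auto intro!: powr_mono2\<close>)
  thus ?thesis using assms by (simp add: Lspace_def)
qed

text \<open>The times \<open>p n\<close> in the sum are at most \<open>D\<close>, of order
  \<open>k ^ (4 * c * d)\<close>, so transference needs the modulus \<open>2 * D + 1\<close>; it is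
  at most \<open>k ^ (c * c)\<close> because \<open>c\<close> exceeds \<open>4 * d\<close> and one
  more factor \<open>k\<close> absorbs the constant. The number 72 is twice the square of 6. Since
  \<open>g\<close> is quantified after \<open>k\<close>, it may be truncated at a height depending
  on \<open>k\<close>.\<close>

lemma wsum_L2_bound:
  assumes P: "\<And>n. poly P (int n) = int (p n)" and c: "c \<ge> 4 * degree P + 1"
    and small: "small_exponential_sums w P c"
  shows "\<forall>\<^sub>F k in sequentially. \<forall>g\<in>Lspace M 2.
    (LINT x|M. (norm (wsum {..<k ^ (4 * c)} g x))\<^sup>2) \<le> 72 * real k ^ (6 * c) * (LINT x|M. (norm (g x))\<^sup>2)"
proof -
  define d where "d = degree P"
  obtain C :: nat where C: "\<And>N n. n < N \<Longrightarrow> \<bar>poly P (int n)\<bar> \<le> int C * int N ^ d"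
    using poly_int_bound[of P] unfolding d_def by metis
  from small eventually_ge_at_top[of "2 * C + 1"] show ?thesis
    unfolding small_exponential_sums_def
  proof eventually_elim
    case (elim k)
    define N where "N = k ^ (4 * c)"
    define D where "D = C * N ^ d"
    have k: "k \<ge> 1" using elim(2) by simp
    have p_le: "p n \<le> D" if "n < N" for n
    proof -
      have "int (p n) \<le> int D" using C[OF that] P[of n] by (simp add: D_def)
      thus ?thesis by simp
    qed
    have "2 * D + 1 \<le> (2 * C + 1) * k ^ (4 * c * d)"
      using k by (simp add: D_def N_def power_mult[symmetric] algebra_simps)
    also have "\<dots> \<le> k * k ^ (4 * c * d)"
      using elim(2) by (intro mult_right_mono) auto
    also have "\<dots> = k ^ (4 * c * d + 1)" by simp
    also have "\<dots> \<le> k ^ (c * c)"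
    proof (rule power_increasing[OF _ k])
      have "4 * c * d + 1 \<le> c * (4 * d + 1)" using c by (simp add: algebra_simps)
      also have "\<dots> \<le> c * c" using c by (intro mult_left_mono) (auto simp: d_def)
      finally show "4 * c * d + 1 \<le> c * c" .
    qed
    finally have K: "2 * D + 1 \<le> k ^ (c * c)" .
    show ?case
    proof
      fix g assume g: "g \<in> Lspace M 2"
      have "(LINT x|M. (norm (wsum {..<N} g x))\<^sup>2) \<le>
          2 * (6 * real k ^ (3 * c))\<^sup>2 * (LINT x|M. (norm (g x))\<^sup>2)"
      proof (rule transference[OF g p_le])
        fix j assume "j < 2 * D + 1"
        thus "norm (\<Sum>n<N. complex_of_real (w n) *
            cis (2 * pi * of_int (int j * int (p n)) / of_nat (2 * D + 1))) \<le> 6 * real k ^ (3 * c)"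
          using elim(1) K unfolding P N_def by blast
      qed auto
      also have "2 * (6 * real k ^ (3 * c))\<^sup>2 = 72 * real k ^ (6 * c)"
        by (simp add: power_mult_distrib power_mult[symmetric] mult.commute)
      finally show "(LINT x|M. (norm (wsum {..<k ^ (4 * c)} g x))\<^sup>2)
          \<le> 72 * real k ^ (6 * c) * (LINT x|M. (norm (g x))\<^sup>2)"
        unfolding N_def .
    qed
  qed
qed

text \<open>Truncating at height \<open>k ^ h\<close>: the lower part is controlled in \<open>L\<^sup>2\<close> by the exponential
  sums, the upper part in \<open>L\<^sup>1\<close> by the integrability of order \<open>r > 1\<close>.\<close>

lemma AE_subsequence:
  assumes P: "\<And>n. poly P (int n) = int (p n)" and r: "r > 1" and g: "g \<in> Lspace M r"
    and h: "real h * (r - 1) > 1" and c: "c \<ge> 4 * degree P + 1" "c \<ge> h + 1"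
    and small: "small_exponential_sums w P c"
  shows "AE x in M. (\<lambda>k. norm (wsum {..<k ^ (4 * c)} g x) / real k ^ (4 * c)) \<longlonglongrightarrow> 0"
proof -
  have [measurable]: "g \<in> borel_measurable M" and int: "integrable M (\<lambda>x. norm (g x) powr r)"
    using g by (auto simp: Lspace_def)
  define lo where "lo k x = (if norm (g x) \<le> real k ^ h then g x else 0)" for k :: nat and x
  define up where "up k x = g x - lo k x" for k :: nat and x
  have [measurable]: "lo k \<in> borel_measurable M" "up k \<in> borel_measurable M" for k
    unfolding up_def lo_def by measurable
  have lo_le: "norm (lo k x) \<le> real k ^ h" for k x by (simp add: lo_def)
  have lo2: "lo k \<in> Lspace M 2" for k
    by (rule bounded_in_Lspace[OF _ lo_le]) auto
  define W where "W k u x = norm (wsum {..<k ^ (4 * c)} u x) / real k ^ (4 * c)" for k u x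
  have [measurable]: "u \<in> borel_measurable M \<Longrightarrow> W k u \<in> borel_measurable M" for k u
    unfolding W_def by (intro borel_measurable_divide borel_measurable_const) measurable
  have intX: "integrable M (\<lambda>x. (W k (lo k) x)\<^sup>2)" for k
    using wsum_powr(1)[OF lo2, of "{..<k ^ (4 * c)}" k] by (simp add: W_def power_divide Lspace_def)
  have sumX: "summable (\<lambda>k. LINT x|M. (W k (lo k) x)\<^sup>2)"
  proof (rule summable_comparison_test_ev)
    show "summable (\<lambda>k. 72 * (1 / real k ^ 2))"
      using inverse_power_summable[of 2, where 'a = real] by (intro summable_mult) (simp add: inverse_eq_divide)
    from wsum_L2_bound[OF P c(1) small] eventually_ge_at_top[of 1]
    show "\<forall>\<^sub>F k in sequentially. norm (LINT x|M. (W k (lo k) x)\<^sup>2) \<le> 72 * (1 / real k ^ 2)"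
    proof eventually_elim
      case (elim k)
      have "(LINT x|M. (norm (lo k x))\<^sup>2) \<le> (LINT x|M. (real k ^ h)\<^sup>2)"
        using lo2[of k] lo_le by (intro integral_mono) (auto simp: Lspace_def intro!: power_mono)
      also have "\<dots> = real k ^ (2 * h)" by (simp add: prob_space power_mult[symmetric] mult.commute)
      finally have lo_int: "(LINT x|M. (norm (lo k x))\<^sup>2) \<le> real k ^ (2 * h)" .
      have "(LINT x|M. (W k (lo k) x)\<^sup>2) = (LINT x|M. (norm (wsum {..<k ^ (4 * c)} (lo k) x))\<^sup>2) / real k ^ (8 * c)"
        by (simp add: W_def power_divide power_mult[symmetric] mult.commute)
      also have "\<dots> \<le> (72 * real k ^ (6 * c) * (LINT x|M. (norm (lo k x))\<^sup>2)) / real k ^ (8 * c)"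
        using elim(1) lo2[of k] by (intro divide_right_mono) auto
      also have "\<dots> \<le> (72 * real k ^ (6 * c) * real k ^ (2 * h)) / real k ^ (8 * c)"
        using lo_int by (intro divide_right_mono mult_left_mono) auto
      \<comment> \<open>The saving \<open>k ^ (2 * c)\<close> from the exponential sums pays for the
        truncation height \<open>k ^ (2 * h)\<close> and leaves \<open>k ^ 2\<close>, since
        \<open>c \<ge> h + 1\<close>.\<close>
      also have "\<dots> \<le> 72 * (1 / real k ^ 2)"
      proof -
        have "real k ^ (6 * c) * real k ^ (2 * h) * real k ^ 2 = real k ^ (6 * c + 2 * h + 2)"
          by (simp add: power_add power2_eq_square)
        also have "\<dots> \<le> real k ^ (8 * c)" using elim(2) c(2) by (intro power_increasing) auto
        finally show ?thesis using elim(2) by (simp add: field_simps)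
      qed
      finally show ?case by simp
    qed
  qed
  have X: "AE x in M. (\<lambda>k. (W k (lo k) x)\<^sup>2) \<longlonglongrightarrow> 0"
    by (rule AE_tendsto_zero_of_summable[OF intX _ sumX]) auto
  \<comment> \<open>Where \<open>up k\<close> is not zero, \<open>norm (g x)\<close> exceeds
    \<open>k ^ h\<close>, so its power with the negative exponent \<open>1 - r\<close> is at most
    that of the height.\<close>
  have up_le: "norm (up k x) \<le> real k powr (real h * (1 - r)) * norm (g x) powr r" if "k \<ge> 1" for k x
  proof (cases "norm (g x) \<le> real k ^ h")
    case True
    thus ?thesis by (simp add: up_def lo_def)
  next
    case False
    have H: "real k ^ h = real k powr real h" "real k ^ h > 0" using that by (auto simp: powr_realpow)
    have pos: "norm (g x) > 0" using False H(2) by linarith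
    have "norm (up k x) = norm (g x) powr (1 - r) * norm (g x) powr r"
      using False pos by (simp add: up_def lo_def powr_add[symmetric])
    also have "norm (g x) powr (1 - r) \<le> (real k ^ h) powr (1 - r)"
      using False H(2) r by (intro powr_mono2') auto
    also have "(real k ^ h) powr (1 - r) = real k powr (real h * (1 - r))"
      by (simp add: H(1) powr_powr)
    finally show ?thesis by (simp add: mult_right_mono)
  qed
  have up1: "up k \<in> Lspace M 1" if "k \<ge> 1" for k
  proof -
    have "integrable M (\<lambda>x. norm (up k x))"
      by (rule Bochner_Integration.integrable_bound[OF integrable_mult_right[OF int, of "real k powr (real h * (1 - r))"]])
         (use up_le[OF that] in auto)
    thus ?thesis by (simp add: Lspace_def)
  qed
  \<comment> \<open>Indices start at 1: at \<open>k = 0\<close> the power with negative exponent has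
    the default value 0 and \<open>up_le\<close> may fail.\<close>
  have intY: "integrable M (W (Suc k) (up (Suc k)))" for k
    using wsum_powr(1)[OF up1[of "Suc k"], of "{..<Suc k ^ (4 * c)}"]
    unfolding W_def by (simp add: Lspace_def)
  have "summable (\<lambda>k. LINT x|M. W (Suc k) (up (Suc k)) x)"
  proof (rule summable_comparison_test)
    have "summable (\<lambda>k. real k powr (real h * (1 - r)))"
      using h by (simp add: summable_real_powr_iff algebra_simps)
    hence "summable (\<lambda>k. real (Suc k) powr (real h * (1 - r)))" by (rule summable_Suc_iff[THEN iffD2])
    thus "summable (\<lambda>k. real (Suc k) powr (real h * (1 - r)) * (LINT x|M. norm (g x) powr r))"
      by (rule summable_mult2)
    have "norm (LINT x|M. W (Suc k) (up (Suc k)) x) \<le>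
        real (Suc k) powr (real h * (1 - r)) * (LINT x|M. norm (g x) powr r)" for k
    proof -
      let ?n = "real (Suc k) ^ (4 * c)"
      have "(LINT x|M. W (Suc k) (up (Suc k)) x) =
          (LINT x|M. norm (wsum {..<Suc k ^ (4 * c)} (up (Suc k)) x)) / ?n"
        by (simp add: W_def)
      also have "\<dots> \<le> (?n * (LINT x|M. norm (up (Suc k) x))) / ?n"
        using wsum_powr(2)[OF up1[of "Suc k"], of "{..<Suc k ^ (4 * c)}"]
        by (intro divide_right_mono) auto
      also have "\<dots> = (LINT x|M. norm (up (Suc k) x))" by simp
      also have "\<dots> \<le> (LINT x|M. real (Suc k) powr (real h * (1 - r)) * norm (g x) powr r)"
        using up1[of "Suc k"] int up_le[of "Suc k"] by (intro integral_mono) (auto simp: Lspace_def)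
      also have "\<dots> = real (Suc k) powr (real h * (1 - r)) * (LINT x|M. norm (g x) powr r)"
        by simp
      finally have "(LINT x|M. W (Suc k) (up (Suc k)) x) \<le>
        real (Suc k) powr (real h * (1 - r)) * (LINT x|M. norm (g x) powr r)" .
      moreover have "(LINT x|M. W (Suc k) (up (Suc k)) x) \<ge> 0"
        by (intro integral_nonneg_AE) (auto simp: W_def)
      ultimately show ?thesis by simp
    qed
    thus "\<exists>N. \<forall>k\<ge>N. norm (LINT x|M. W (Suc k) (up (Suc k)) x) \<le>
        real (Suc k) powr (real h * (1 - r)) * (LINT x|M. norm (g x) powr r)" by blast
  qed
  hence Y: "AE x in M. (\<lambda>k. W (Suc k) (up (Suc k)) x) \<longlonglongrightarrow> 0"
    by (intro AE_tendsto_zero_of_summable[OF intY]) (auto simp: W_def)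
  from X Y show ?thesis
  proof eventually_elim
    case (elim x)
    have "(\<lambda>k. sqrt ((W k (lo k) x)\<^sup>2)) \<longlonglongrightarrow> sqrt 0"
      using elim(1) by (rule tendsto_real_sqrt)
    hence "(\<lambda>k. W k (lo k) x) \<longlonglongrightarrow> 0" by (simp add: W_def)
    moreover have "(\<lambda>k. W k (up k) x) \<longlonglongrightarrow> 0"
      using elim(2) by (rule LIMSEQ_imp_Suc)
    ultimately have lim: "(\<lambda>k. W k (lo k) x + W k (up k) x) \<longlonglongrightarrow> 0"
      using tendsto_add[of "\<lambda>k. W k (lo k) x" 0 sequentially "\<lambda>k. W k (up k) x" 0] by simp
    have "W k g x \<le> W k (lo k) x + W k (up k) x" for k
    proof -
      have "wsum {..<k ^ (4 * c)} g x = wsum {..<k ^ (4 * c)} (lo k) x + wsum {..<k ^ (4 * c)} (up k) x"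
        by (simp add: up_def wsum_diff[of _ g "lo k", folded up_def])
      thus ?thesis
        unfolding W_def by (simp add: add_divide_distrib[symmetric] divide_right_mono norm_triangle_ineq)
    qed
    hence "(\<lambda>k. W k g x) \<longlonglongrightarrow> 0"
      by (intro tendsto_sandwich[OF _ _ tendsto_const lim]) (auto simp: W_def)
    thus ?case unfolding W_def .
  qed
qed

text \<open>Consecutive lengths \<open>k ^ m\<close> and \<open>Suc k ^ m\<close> differ by a factor \<open>1 + O(1/k)\<close>, and
  \<open>(1/k) powr r\<close> is summable: this is why no maximal inequality is needed.\<close>

lemma AE_gaps:
  assumes r: "r > 1" and g: "g \<in> Lspace M r"
  shows "AE x in M. (\<lambda>k. (\<Sum>n\<in>{k ^ m..<Suc k ^ m}. norm (g ((T ^^ p n) x))) / real (k ^ m)) \<longlonglongrightarrow> 0"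
proof -
  define Z where "Z k x = (\<Sum>n\<in>{k ^ m..<Suc k ^ m}. norm (g ((T ^^ p n) x))) / real (k ^ m)" for k x
  have Z0: "0 \<le> Z k x" for k x by (simp add: Z_def sum_nonneg)
  have Zr: "Z k x powr r = (\<Sum>n\<in>{k ^ m..<Suc k ^ m}. norm (g ((T ^^ p n) x))) powr r / real (k ^ m) powr r" for k x
    unfolding Z_def by (rule powr_divide)
  have r1: "r \<ge> 1" using r by simp
  note gap = abs_sum_powr[OF g r1, of "{k ^ m..<Suc k ^ m}" for k]
  have intZ: "integrable M (\<lambda>x. Z k x powr r)" for k
    unfolding Zr using gap(1)[of k] by simp
  have "summable (\<lambda>k. LINT x|M. Z k x powr r)"
  proof (rule summable_comparison_test)
    have "summable (\<lambda>k. real k powr (- r))" using r by (simp add: summable_real_powr_iff)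
    thus "summable (\<lambda>k. real k powr (- r) * ((2 ^ m) powr r * (LINT x|M. norm (g x) powr r)))"
      by (rule summable_mult2)
    have "norm (LINT x|M. Z k x powr r) \<le> real k powr (- r) * ((2 ^ m) powr r * (LINT x|M. norm (g x) powr r))"
      if k: "k \<ge> 1" for k
    proof -
      have "(LINT x|M. Z k x powr r) \<le>
          real (Suc k ^ m - k ^ m) powr r * (LINT x|M. norm (g x) powr r) / real (k ^ m) powr r"
        unfolding Zr using gap(2)[of k] by (simp add: divide_right_mono)
      also have "\<dots> = (real (Suc k ^ m - k ^ m) / real (k ^ m)) powr r * (LINT x|M. norm (g x) powr r)"
        by (simp add: powr_divide)
      also have "\<dots> \<le> (2 ^ m / real k) powr r * (LINT x|M. norm (g x) powr r)"
        using power_gap_le[OF k, of m] r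
        by (intro mult_right_mono powr_mono2) (auto intro!: integral_nonneg_AE)
      also have "\<dots> = real k powr (- r) * ((2 ^ m) powr r * (LINT x|M. norm (g x) powr r))"
        using k by (simp add: powr_divide powr_minus_divide)
      finally show ?thesis by (simp add: integral_nonneg_AE)
    qed
    thus "\<exists>N. \<forall>k\<ge>N. norm (LINT x|M. Z k x powr r)
        \<le> real k powr (- r) * ((2 ^ m) powr r * (LINT x|M. norm (g x) powr r))" by blast
  qed
  hence "AE x in M. (\<lambda>k. Z k x powr r) \<longlonglongrightarrow> 0"
    by (intro AE_tendsto_zero_of_summable[OF intZ]) auto
  hence "AE x in M. (\<lambda>k. Z k x) \<longlonglongrightarrow> 0"
    by eventually_elim (use r Z0 in \<open>auto intro: tendsto_zero_powr_cancel\<close>)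
  thus ?thesis by (simp add: Z_def)
qed

text \<open>For \<open>N\<close> in the block of \<open>k\<close>, the sum up to \<open>N\<close>
  differs from the one up to \<open>k ^ m\<close> by at most the absolute sum over the whole gap;
  both tend to 0 after division by \<open>k ^ m\<close>.\<close>

lemma AE_wsum_tendsto:
  assumes P: "\<And>n. poly P (int n) = int (p n)" and r: "r > 1" and g: "g \<in> Lspace M r"
    and small: "\<And>c. c \<ge> 1 \<Longrightarrow> small_exponential_sums w P c"
  shows "AE x in M. (\<lambda>N. wsum {..<N} g x / of_nat N) \<longlonglongrightarrow> 0"
proof -
  obtain h :: nat where "real h > 1 / (r - 1)" using reals_Archimedean2 by blast
  hence h: "real h * (r - 1) > 1" using r by (simp add: field_simps)
  \<comment> \<open>Meets two demands at once: the degree term makes the available moduli large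
    enough, and \<open>h + 1\<close> covers the truncation height.\<close>
  define c where "c = h + 4 * degree P + 1"
  define m where "m = 4 * c"
  have c: "c \<ge> 4 * degree P + 1" "c \<ge> h + 1" "c \<ge> 1" by (auto simp: c_def)
  from AE_subsequence[OF P r g h c(1,2) small[OF c(3)]] AE_gaps[OF r g, of m] show ?thesis
  proof eventually_elim
    case (elim x)
    define u where "u k = norm (wsum {..<k ^ m} g x) / real (k ^ m)
      + (\<Sum>n\<in>{k ^ m..<Suc k ^ m}. norm (g ((T ^^ p n) x))) / real (k ^ m)" for k
    have "u \<longlonglongrightarrow> 0 + 0" unfolding u_def
      using elim by (intro tendsto_add) (simp_all add: m_def)
    hence u: "u \<longlonglongrightarrow> 0" by simp
    show "(\<lambda>N. wsum {..<N} g x / of_nat N) \<longlonglongrightarrow> 0"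
    proof (rule tendsto_zero_of_blocks[OF _ _ u])
      show "m \<ge> 1" using c by (simp add: m_def)
      fix k N :: nat assume k: "k \<ge> 1" and N: "k ^ m \<le> N" "N < Suc k ^ m"
      have split: "{..<N} = {..<k ^ m} \<union> {k ^ m..<N}" using N by auto
      have "wsum {..<N} g x = wsum {..<k ^ m} g x + wsum {k ^ m..<N} g x"
        unfolding wsum_def by (subst split, rule sum.union_disjoint) auto
      hence "norm (wsum {..<N} g x) \<le> norm (wsum {..<k ^ m} g x) + norm (wsum {k ^ m..<N} g x)"
        by (simp add: norm_triangle_ineq)
      also have "norm (wsum {k ^ m..<N} g x) \<le> (\<Sum>n\<in>{k ^ m..<N}. norm (g ((T ^^ p n) x)))"
        by (rule norm_wsum_le)
      also have "\<dots> \<le> (\<Sum>n\<in>{k ^ m..<Suc k ^ m}. norm (g ((T ^^ p n) x)))"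
        using N by (intro sum_mono2) auto
      finally have "norm (wsum {..<N} g x) \<le>
          norm (wsum {..<k ^ m} g x) + (\<Sum>n\<in>{k ^ m..<Suc k ^ m}. norm (g ((T ^^ p n) x)))" by simp
      also have "\<dots> = u k * real (k ^ m)"
        using k by (simp add: u_def distrib_right)
      also have "\<dots> \<le> u k * real N"
        using N by (intro mult_left_mono) (auto simp: u_def sum_nonneg simp flip: of_nat_power)
      finally show "norm (wsum {..<N} g x / of_nat N) \<le> u k"
        using N k by (cases "N = 0") (auto simp: norm_divide field_simps)
    qed
  qed
qed

section \<open>Convergence in L^r norm\<close>

lemma wsum_average_powr:
  assumes r: "r > 1" and g: "g \<in> Lspace M r"
  shows "(\<lambda>x. wsum {..<N} g x / of_nat N) \<in> Lspace M r"
    and "(LINT x|M. norm (wsum {..<N} g x / of_nat N) powr r) \<le> (LINT x|M. norm (g x) powr r)"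
proof -
  have eq: "norm (wsum {..<N} g x / of_nat N) powr r = norm (wsum {..<N} g x) powr r / real N powr r" for x
    by (simp add: norm_divide powr_divide)
  note bound = wsum_powr[OF g, of "{..<N}"]
  show "(\<lambda>x. wsum {..<N} g x / of_nat N) \<in> Lspace M r"
  proof -
    have "integrable M (\<lambda>x. norm (wsum {..<N} g x / of_nat N) powr r)"
      unfolding eq using bound(1) r by (simp add: Lspace_def)
    moreover have "(\<lambda>x. wsum {..<N} g x / of_nat N) \<in> borel_measurable M"
      using g by (intro borel_measurable_divide borel_measurable_const measurable_wsum) (simp add: Lspace_def)
    ultimately show ?thesis by (simp add: Lspace_def)
  qed
  have "(LINT x|M. norm (wsum {..<N} g x / of_nat N) powr r) \<le>
      real N powr r * (LINT x|M. norm (g x) powr r) / real N powr r"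
    unfolding eq integral_divide_zero using bound(2) r by (intro divide_right_mono) auto
  \<comment> \<open>At \<open>N = 0\<close> the quotient is 0, so only nonnegativity of the right
    side remains.\<close>
  also have "\<dots> \<le> (LINT x|M. norm (g x) powr r)"
    by (cases "N = 0") (auto intro!: integral_nonneg_AE)
  finally show "(LINT x|M. norm (wsum {..<N} g x / of_nat N) powr r) \<le> (LINT x|M. norm (g x) powr r)" .
qed

text \<open>Dominated convergence: with weights at most 1 in absolute value the averages inherit the
  bound \<open>H\<close>, a constant, integrable on a probability space.\<close>

lemma Lp_convergence_bounded:
  assumes r: "r > 1" and [measurable]: "g \<in> borel_measurable M" and H: "\<And>x. norm (g x) \<le> H"
    and ae: "AE x in M. (\<lambda>N. wsum {..<N} g x / of_nat N) \<longlonglongrightarrow> 0"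
  shows "(\<lambda>N. LINT x|M. norm (wsum {..<N} g x / of_nat N) powr r) \<longlonglongrightarrow> 0"
proof -
  have H0: "H \<ge> 0" using H order.trans[OF norm_ge_zero] by blast
  have le: "norm (wsum {..<N} g x / of_nat N) \<le> H" for N x
  proof (cases "N = 0")
    case False
    have "norm (wsum {..<N} g x) \<le> (\<Sum>n<N. H)"
      by (rule order.trans[OF norm_wsum_le sum_mono]) (rule H)
    thus ?thesis using False by (simp add: norm_divide field_simps)
  qed (use H0 in simp)
  have "(\<lambda>N. LINT x|M. norm (wsum {..<N} g x / of_nat N) powr r) \<longlonglongrightarrow> (LINT x|M. 0)"
  proof (rule integral_dominated_convergence)
    show "AE x in M. (\<lambda>N. norm (wsum {..<N} g x / of_nat N) powr r) \<longlonglongrightarrow> 0"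
      using ae
    proof eventually_elim
      case (elim x)
      have "(\<lambda>N. norm (wsum {..<N} g x / of_nat N) powr r) \<longlonglongrightarrow> 0 powr r"
        using r by (intro tendsto_powr' tendsto_norm_zero[OF elim]) auto
      thus ?case by simp
    qed
    show "AE x in M. norm (norm (wsum {..<N} g x / of_nat N) powr r) \<le> H powr r" for N
      using r le by (auto intro!: powr_mono2)
  qed auto
  thus ?thesis by simp
qed

text \<open>Density argument: bounded truncations approximate \<open>g\<close> in L^r, and averaging
  does not increase the L^r norm, whatever \<open>N\<close> is. Hypothesis \<open>ae\<close> ranges
  over all \<open>h\<close> because it is applied to a truncation.\<close>

lemma Lp_convergence:
  assumes r: "r > 1" and g: "g \<in> Lspace M r"
    and ae: "\<And>h. h \<in> Lspace M r \<Longrightarrow> AE x in M. (\<lambda>N. wsum {..<N} h x / of_nat N) \<longlonglongrightarrow> 0"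
  shows "(\<lambda>N. LINT x|M. norm (wsum {..<N} g x / of_nat N) powr r) \<longlonglongrightarrow> 0"
proof (rule LIMSEQ_I)
  fix e :: real assume e: "e > 0"
  define A where "A N h x = wsum {..<N} h x / of_nat N" for N h x
  define I where "I h = (LINT x|M. norm (h x) powr r)" for h :: "'x \<Rightarrow> complex"
  have [measurable]: "g \<in> borel_measurable M" and int: "integrable M (\<lambda>x. norm (g x) powr r)"
    using g by (auto simp: Lspace_def)
  define lo where "lo H x = (if norm (g x) \<le> real H then g x else 0)" for H :: nat and x
  have [measurable]: "lo H \<in> borel_measurable M" for H unfolding lo_def by measurable
  have lo_le: "norm (lo H x) \<le> real H" for H x by (simp add: lo_def)
  have lo: "lo H \<in> Lspace M r" for H
    using r by (intro bounded_in_Lspace[OF _ lo_le]) auto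
  have diff_le: "norm (g x - lo H x) powr r \<le> norm (g x) powr r" for H x by (simp add: lo_def)
  have "integrable M (\<lambda>x. norm (g x - lo H x) powr r)" for H
    by (rule Bochner_Integration.integrable_bound[OF int]) (use diff_le in auto)
  hence up: "(\<lambda>x. g x - lo H x) \<in> Lspace M r" for H by (simp add: Lspace_def)
  have "(\<lambda>H. I (\<lambda>x. g x - lo H x)) \<longlonglongrightarrow> (LINT x|M. 0)"
    unfolding I_def
  proof (rule integral_dominated_convergence[OF _ _ int])
    show "AE x in M. (\<lambda>H. norm (g x - lo H x) powr r) \<longlonglongrightarrow> 0"
    proof (intro AE_I2 tendsto_eventually)
      fix x
      obtain K :: nat where K: "norm (g x) \<le> real K" using real_arch_simple by blast
      show "\<forall>\<^sub>F H in sequentially. norm (g x - lo H x) powr r = 0"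
        using eventually_ge_at_top[of K] by eventually_elim (use K in \<open>auto simp: lo_def\<close>)
    qed
  qed (use diff_le in auto)
  hence "(\<lambda>H. I (\<lambda>x. g x - lo H x)) \<longlonglongrightarrow> 0" by simp
  \<comment> \<open>The factor \<open>2 powr (r - 1)\<close> offsets the constant of
    \<open>powr_add_le\<close>, so that two such errors add up to \<open>e\<close>.\<close>
  hence "\<forall>\<^sub>F H in sequentially. I (\<lambda>x. g x - lo H x) < e / (2 * 2 powr (r - 1))"
    by (rule order_tendstoD) (use e in auto)
  then obtain H where H: "I (\<lambda>x. g x - lo H x) < e / (2 * 2 powr (r - 1))"
    by (auto simp: eventually_sequentially)
  have "(\<lambda>N. I (A N (lo H))) \<longlonglongrightarrow> 0"
    unfolding I_def A_def by (intro Lp_convergence_bounded[OF r _ lo_le] ae lo) auto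
  hence "\<forall>\<^sub>F N in sequentially. I (A N (lo H)) < e / (2 * 2 powr (r - 1))"
    by (rule order_tendstoD) (use e in auto)
  hence "\<forall>\<^sub>F N in sequentially. I (A N g) < e"
  proof eventually_elim
    case (elim N)
    have A: "A N (lo H) \<in> Lspace M r" "A N (\<lambda>x. g x - lo H x) \<in> Lspace M r" "A N g \<in> Lspace M r"
      unfolding A_def using wsum_average_powr(1)[OF r] lo up g by auto
    have "I (A N g) \<le> (LINT x|M. 2 powr (r - 1) *
        (norm (A N (lo H) x) powr r + norm (A N (\<lambda>x. g x - lo H x) x) powr r))"
      unfolding I_def
    proof (rule integral_mono)
      fix x
      have "A N g x = A N (lo H) x + A N (\<lambda>x. g x - lo H x) x"
        by (simp add: A_def wsum_diff diff_divide_distrib)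
      hence "norm (A N g x) powr r \<le> (norm (A N (lo H) x) + norm (A N (\<lambda>x. g x - lo H x) x)) powr r"
        using r by (intro powr_mono2) (auto simp: norm_triangle_ineq)
      also have "\<dots> \<le> 2 powr (r - 1) * (norm (A N (lo H) x) powr r + norm (A N (\<lambda>x. g x - lo H x) x) powr r)"
        using r by (intro powr_add_le) auto
      finally show "norm (A N g x) powr r \<le>
        2 powr (r - 1) * (norm (A N (lo H) x) powr r + norm (A N (\<lambda>x. g x - lo H x) x) powr r)" .
    qed (use A in \<open>auto simp: Lspace_def\<close>)
    also have "\<dots> = 2 powr (r - 1) * (I (A N (lo H)) + I (A N (\<lambda>x. g x - lo H x)))"
      using A by (simp add: I_def Lspace_def)
    also have "I (A N (\<lambda>x. g x - lo H x)) \<le> I (\<lambda>x. g x - lo H x)"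
      unfolding I_def A_def by (rule wsum_average_powr(2)[OF r up])
    also have "2 powr (r - 1) * (I (A N (lo H)) + I (\<lambda>x. g x - lo H x)) <
        2 powr (r - 1) * (e / (2 * 2 powr (r - 1)) + e / (2 * 2 powr (r - 1)))"
      using elim H by (intro mult_strict_left_mono add_strict_mono) auto
    also have "\<dots> = e" by (simp add: field_simps)
    finally show ?case by (simp add: mult_left_mono)
  qed
  thus "\<exists>N0. \<forall>N\<ge>N0. norm ((LINT x|M. norm (wsum {..<N} g x / of_nat N) powr r) - 0) < e"
    by (auto simp: eventually_sequentially I_def A_def integral_nonneg_AE)
qed

end

section \<open>From exponential sums to averages, and change of phase space\<close>

lemma averages_vanish_of_small_exponential_sums:
  assumes w: "\<And>n. \<bar>w n\<bar> \<le> 1" and small: "\<And>P c. c \<ge> 1 \<Longrightarrow> small_exponential_sums w P c"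
  shows "averages_vanish TYPE('x) w"
  unfolding averages_vanish_def
proof (intro allI impI)
  fix P :: "int poly" and M :: "'x measure" and T r and g :: "'x \<Rightarrow> complex"
  assume P: "\<forall>n::nat. poly P (int n) \<ge> 0" and mp: "mp_system M T" and r: "r > 1" and g: "g \<in> Lspace M r"
  interpret mp_weighted M T "\<lambda>n. nat (poly P (int n))" w
    using mp w by unfold_locales
  have avg: "weighted_average w P T h N x = wsum {..<N} h x / of_nat N" for h N x
    by (simp add: weighted_average_def wsum_def)
  have ae: "AE x in M. (\<lambda>N. wsum {..<N} h x / of_nat N) \<longlonglongrightarrow> 0" if "h \<in> Lspace M r" for h
    using P by (intro AE_wsum_tendsto[OF _ r that small]) auto
  have "(\<lambda>N. Lnorm M r (weighted_average w P T g N)) \<longlonglongrightarrow> 0 powr (1 / r)"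
    unfolding Lnorm_def avg using r
    by (intro tendsto_powr' Lp_convergence[OF r g ae] tendsto_const) (auto intro!: integral_nonneg_AE)
  moreover have "weighted_average w P T g N \<in> Lspace M r" for N
    using wsum_average_powr(1)[OF r g, of N] by (simp add: avg[abs_def])
  ultimately show "(AE x in M. (\<lambda>N. weighted_average w P T g N x) \<longlonglongrightarrow> 0) \<and>
      Lconv_zero M r (weighted_average w P T g)"
    using ae[OF g] by (simp add: avg Lconv_zero_def)
qed

lemma Lconv_zero_distr:
  assumes [measurable]: "\<phi> \<in> M \<rightarrow>\<^sub>M N" and conv: "Lconv_zero (distr M N \<phi>) r G"
    and eq: "\<And>n x. G n (\<phi> x) = F n x"
  shows "Lconv_zero M r F"
proof -
  have [measurable]: "G n \<in> borel_measurable N" for n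
    using conv by (simp add: Lconv_zero_def Lspace_def)
  have F: "F n = (\<lambda>x. G n (\<phi> x))" for n by (rule ext) (simp add: eq)
  have "F n \<in> Lspace M r" for n
  proof -
    have "integrable (distr M N \<phi>) (\<lambda>y. norm (G n y) powr r)"
      using conv by (simp add: Lconv_zero_def Lspace_def)
    hence "integrable M (\<lambda>x. norm (G n (\<phi> x)) powr r)" by (subst (asm) integrable_distr_eq) auto
    thus ?thesis by (simp add: Lspace_def F)
  qed
  moreover have "Lnorm (distr M N \<phi>) r (G n) = Lnorm M r (F n)" for n
    unfolding Lnorm_def F by (subst integral_distr) auto
  ultimately show ?thesis using conv by (simp add: Lconv_zero_def)
qed

text \<open>The orbit map \<open>x \<mapsto> (g (T\<^sup>n x))\<^sub>n\<close> is a factor map onto a shift on \<open>nat \<Rightarrow> complex\<close>, under which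
  \<open>g\<close> becomes the zeroth coordinate.\<close>

lemma averages_vanish_transfer:
  assumes av: "averages_vanish TYPE(nat \<Rightarrow> complex) w"
  shows "averages_vanish TYPE('x) w"
  unfolding averages_vanish_def
proof (intro allI impI)
  fix P :: "int poly" and M :: "'x measure" and T r and g :: "'x \<Rightarrow> complex"
  assume P: "degree P \<ge> 1" "\<forall>n::nat. poly P (int n) \<ge> 0"
    and mp: "mp_system M T" and r: "r > 1" and g: "g \<in> Lspace M r"
  interpret prob_space M using mp by (simp add: mp_system_def)
  have [measurable]: "T \<in> M \<rightarrow>\<^sub>M M" "g \<in> borel_measurable M"
    using mp g by (auto simp: mp_system_def Lspace_def)
  define S where "S = PiM (UNIV :: nat set) (\<lambda>_. borel :: complex measure)"
  define \<phi> where "\<phi> x n = g ((T ^^ n) x)" for x and n :: nat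
  define shift where "shift s n = s (Suc n)" for s :: "nat \<Rightarrow> complex" and n
  define M' where "M' = distr M S \<phi>"
  have pow: "T ^^ n \<in> M \<rightarrow>\<^sub>M M" for n
    by (induction n) (auto intro: measurable_comp)
  have \<phi> [measurable]: "\<phi> \<in> M \<rightarrow>\<^sub>M S"
    unfolding S_def \<phi>_def
    by (rule measurable_PiM_single') (auto intro: measurable_compose[OF pow] simp: space_PiM PiE_def extensional_def)
  have coord [measurable]: "(\<lambda>s. s n) \<in> borel_measurable S" for n
    unfolding S_def by (rule measurable_component_singleton) simp
  have shift [measurable]: "shift \<in> S \<rightarrow>\<^sub>M S"
    unfolding shift_def by (subst (2) S_def, rule measurable_PiM_single') (auto simp: space_PiM PiE_def extensional_def)
  have comm: "shift (\<phi> x) = \<phi> (T x)" for x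
    by (rule ext) (simp add: shift_def \<phi>_def funpow_swap1)
  have shift_pow: "(shift ^^ n) (\<phi> x) = \<phi> ((T ^^ n) x)" for n x
    by (induction n) (simp_all add: comm)
  have avg: "weighted_average w P shift (\<lambda>s. s 0) N (\<phi> x) = weighted_average w P T g N x" for N x
    by (simp add: weighted_average_def shift_pow) (simp add: \<phi>_def)
  have "distr M' M' shift = M'"
  proof -
    have "distr M' M' shift = distr M' S shift"
      by (rule distr_cong) (auto simp: M'_def)
    also have "\<dots> = distr M S (shift \<circ> \<phi>)"
      unfolding M'_def by (rule distr_distr) measurable
    \<comment> \<open>Intertwining carries the invariance under \<open>T\<close> over to invariance
      of the image measure under the shift.\<close>
    also have "shift \<circ> \<phi> = \<phi> \<circ> T" by (rule ext) (simp add: comm)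
    also have "distr M S (\<phi> \<circ> T) = distr (distr M M T) S \<phi>"
      by (rule distr_distr[symmetric]) measurable
    finally show ?thesis using mp by (simp add: mp_system_def M'_def)
  qed
  moreover have "prob_space M'"
    unfolding M'_def by (rule prob_space_distr) measurable
  moreover have "shift \<in> M' \<rightarrow>\<^sub>M M'"
    by (simp add: M'_def)
  ultimately have mp': "mp_system M' shift" by (simp add: mp_system_def)
  have g': "(\<lambda>s. s 0) \<in> Lspace M' r"
  proof -
    have "integrable M (\<lambda>x. norm (\<phi> x 0) powr r)"
      using g by (simp add: \<phi>_def Lspace_def)
    hence "integrable M' (\<lambda>s. norm (s 0) powr r)"
      unfolding M'_def by (subst integrable_distr_eq) auto
    thus ?thesis by (simp add: Lspace_def M'_def)
  qed
  from av P mp' r g' have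
    ae: "AE s in M'. (\<lambda>N. weighted_average w P shift (\<lambda>s. s 0) N s) \<longlonglongrightarrow> 0" and
    conv: "Lconv_zero M' r (weighted_average w P shift (\<lambda>s. s 0))"
    unfolding averages_vanish_def by blast+
  show "(AE x in M. (\<lambda>N. weighted_average w P T g N x) \<longlonglongrightarrow> 0) \<and>
      Lconv_zero M r (weighted_average w P T g)"
  proof
    show "AE x in M. (\<lambda>N. weighted_average w P T g N x) \<longlonglongrightarrow> 0"
      using AE_distrD[OF \<phi> ae[unfolded M'_def]] by (simp add: avg)
    show "Lconv_zero M r (weighted_average w P T g)"
      by (rule Lconv_zero_distr[OF \<phi> conv[unfolded M'_def]]) (rule avg)
  qed
qed

section \<open>Determinantal processes\<close>

abbreviation circle :: "real measure" where
  "circle \<equiv> restrict_space lborel {0..<1}"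

lemma prob_space_circle: "prob_space circle"
  by (rule prob_space_restrict_space) auto

lemma borel_measurable_circle:
  "h \<in> borel_measurable borel \<Longrightarrow> h \<in> borel_measurable circle"
  by (simp add: measurable_restrict_space1)

lemma fourier_coeff_circle:
  "fourier_coeff f n = (LINT t|circle. complex_of_real (f t) * cis (- (2 * pi * of_int n * t)))"
proof -
  have "exp (- 2 * of_real pi * \<i> * of_int n * of_real t) = cis (- (2 * pi * of_int n * t))" for t
    unfolding cis_conv_exp by (rule arg_cong[where f = exp]) simp
  thus ?thesis
    unfolding fourier_coeff_def set_lebesgue_integral_def
    by (subst integral_restrict_space) simp_all
qed

lemma borel_measurable_cis [measurable]: "(\<lambda>t. cis (a * t)) \<in> borel_measurable borel"
  by (intro borel_measurable_continuous_onI continuous_intros)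

text \<open>The form at \<open>v\<close> is the integral of \<open>f\<close> times the squared
  modulus of the trigonometric polynomial with frequencies \<open>m j\<close> and coefficients
  \<open>v j\<close>.\<close>

lemma pos_semidef_fourier_coeff:
  fixes m :: "nat \<Rightarrow> int"
  assumes f [measurable]: "f \<in> borel_measurable borel" and f01: "\<And>t. 0 \<le> f t \<and> f t \<le> 1"
  shows "pos_semidef k (\<lambda>i j. fourier_coeff f (m i - m j))"
  unfolding pos_semidef_def
proof safe
  fix i j
  show "fourier_coeff f (m j - m i) = cnj (fourier_coeff f (m i - m j))"
    unfolding fourier_coeff_circle Bochner_Integration.integral_cnj[symmetric]
    by (rule Bochner_Integration.integral_cong) (simp_all add: cis_cnj algebra_simps)
next
  interpret prob_space circle by (rule prob_space_circle)
  fix v :: "nat \<Rightarrow> complex"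
  define e where "e i t = cis (2 * pi * of_int (m i) * t)" for i t
  have e_diff: "cis (- (2 * pi * of_int (m i - m j) * t)) = cnj (e i t) * e j t" for i j t
    by (simp add: e_def cis_cnj cis_mult algebra_simps)
  have coeff: "fourier_coeff f (m i - m j) = (LINT t|circle. complex_of_real (f t) * (cnj (e i t) * e j t))" for i j
    unfolding fourier_coeff_circle e_diff ..
  have int: "integrable circle (\<lambda>t. complex_of_real (f t) * (cnj (e i t) * e j t))" for i j
  proof (rule integrable_const_bound[of _ 1])
    show "AE t in circle. norm (complex_of_real (f t) * (cnj (e i t) * e j t)) \<le> 1"
      using f01 by (auto simp: norm_mult e_def)
    have "(\<lambda>t. complex_of_real (f t) * cis (- (2 * pi * of_int (m i - m j)) * t)) \<in> borel_measurable borel"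
      by measurable
    thus "(\<lambda>t. complex_of_real (f t) * (cnj (e i t) * e j t)) \<in> borel_measurable circle"
      unfolding e_diff[symmetric] by (intro borel_measurable_circle) simp
  qed
  have "(\<Sum>i<k. \<Sum>j<k. cnj (v i) * fourier_coeff f (m i - m j) * v j) =
      (LINT t|circle. (\<Sum>i<k. \<Sum>j<k. cnj (v i) * (complex_of_real (f t) * (cnj (e i t) * e j t)) * v j))"
    unfolding coeff using int by simp
  also have "\<dots> = (LINT t|circle. complex_of_real (f t * (norm (\<Sum>j<k. v j * e j t))\<^sup>2))"
  proof (rule Bochner_Integration.integral_cong[OF refl])
    fix t
    have "complex_of_real ((norm (\<Sum>j<k. v j * e j t))\<^sup>2) =
        (\<Sum>i<k. cnj (v i) * cnj (e i t)) * (\<Sum>j<k. v j * e j t)"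
      unfolding complex_norm_square by (simp add: mult.commute)
    also have "\<dots> = (\<Sum>i<k. \<Sum>j<k. cnj (v i) * cnj (e i t) * (v j * e j t))"
      by (rule sum_product)
    finally show "(\<Sum>i<k. \<Sum>j<k. cnj (v i) * (complex_of_real (f t) * (cnj (e i t) * e j t)) * v j) =
        complex_of_real (f t * (norm (\<Sum>j<k. v j * e j t))\<^sup>2)"
      unfolding of_real_mult by (simp only: sum_distrib_left mult_ac)
  qed
  also have "\<dots> = complex_of_real (LINT t|circle. f t * (norm (\<Sum>j<k. v j * e j t))\<^sup>2)"
    by (rule integral_complex_of_real)
  finally show "0 \<le> Re (\<Sum>i<k. \<Sum>j<k. cnj (v i) * fourier_coeff f (m i - m j) * v j)"
    using f01 by (simp add: integral_nonneg_AE)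
qed

lemma fourier_coeff_0: "fourier_coeff f 0 = complex_of_real (LINT t:{0..<1}|lborel. f t)"
  unfolding fourier_coeff_def by (simp add: set_integral_complex_of_real)

text \<open>For any distinct points the matrix has constant diagonal
  \<open>fourier_coeff f 0\<close>, the mean of \<open>f\<close>, so Hadamard's inequality is
  exactly the product bound; a single point gives the expectation.\<close>

lemma determinantal_sub_bernoulli:
  assumes f: "f \<in> borel_measurable borel" "\<And>t. 0 \<le> f t \<and> f t \<le> 1"
    and dpp: "determinantal_process \<Omega> (\<lambda>n m. fourier_coeff f (n - m)) \<X>"
  shows "sub_bernoulli \<Omega> (\<lambda>n \<omega>. indicator (\<X> \<omega>) (int n)) (LINT t:{0..<1}|lborel. f t)"
proof -
  interpret prob_space \<Omega> using dpp by (simp add: determinantal_process_def)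
  define s where "s = (LINT t:{0..<1}|lborel. f t)"
  have det: "complex_of_real (LINT \<omega>|\<Omega>. (\<Prod>n\<leftarrow>ns. indicat_real (\<X> \<omega>) n)) =
      Determinant.det (Matrix.mat (length ns) (length ns) (\<lambda>(i, j). fourier_coeff f (ns ! i - ns ! j)))"
    if "distinct ns" for ns
    using dpp that by (simp add: determinantal_process_def)
  have le: "(LINT \<omega>|\<Omega>. (\<Prod>n\<leftarrow>ns. indicat_real (\<X> \<omega>) n)) \<le> s ^ length ns" if "distinct ns" for ns
  proof -
    from Hadamard_inequality[OF pos_semidef_fourier_coeff[OF f, where m = "\<lambda>i. ns ! i" and k = "length ns"]]
    obtain d where d: "Determinant.det (Matrix.mat (length ns) (length ns)
        (\<lambda>(i, j). fourier_coeff f (ns ! i - ns ! j))) = complex_of_real d"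
      "d \<le> (\<Prod>i<length ns. Re (fourier_coeff f (ns ! i - ns ! i)))"
      by blast
    from det[OF that] d(1) have "(LINT \<omega>|\<Omega>. (\<Prod>n\<leftarrow>ns. indicat_real (\<X> \<omega>) n)) = d"
      by (simp only: of_real_eq_iff)
    thus ?thesis using d(2) by (simp add: fourier_coeff_0 s_def)
  qed
  have "sub_bernoulli_axioms \<Omega> (\<lambda>n \<omega>. indicator (\<X> \<omega>) (int n)) s"
  proof
    fix n :: nat
    have "{\<omega> \<in> space \<Omega>. int n \<in> \<X> \<omega>} \<in> sets \<Omega>"
      using dpp by (simp add: determinantal_process_def)
    hence "indicat_real {\<omega> \<in> space \<Omega>. int n \<in> \<X> \<omega>} \<in> borel_measurable \<Omega>" by simp
    also have "?this \<longleftrightarrow> (\<lambda>\<omega>. indicat_real (\<X> \<omega>) (int n)) \<in> borel_measurable \<Omega>"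
      by (rule measurable_cong) (auto simp: indicator_def)
    finally show "(\<lambda>\<omega>. indicat_real (\<X> \<omega>) (int n)) \<in> borel_measurable \<Omega>" .
    show "indicator (\<X> \<omega>) (int n) = (0::real) \<or> indicator (\<X> \<omega>) (int n) = (1::real)" for \<omega>
      by (auto simp: indicator_def)
    have "complex_of_real (expectation (\<lambda>\<omega>. indicator (\<X> \<omega>) (int n))) = complex_of_real s"
      using det[of "[int n]"] by (simp add: fourier_coeff_0 s_def det_single)
    thus "expectation (\<lambda>\<omega>. indicator (\<X> \<omega>) (int n)) = s" by (simp only: of_real_eq_iff)
  next
    fix S :: "nat set" assume S: "finite S"
    let ?ns = "map int (sorted_list_of_set S)"
    have "(\<Prod>n\<leftarrow>?ns. indicat_real (\<X> \<omega>) n) = (\<Prod>n\<in>S. indicat_real (\<X> \<omega>) (int n))" for \<omega>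
      using S prod.distinct_set_conv_list[of "sorted_list_of_set S" "\<lambda>n. indicat_real (\<X> \<omega>) (int n)"]
      by (simp add: comp_def)
    thus "expectation (\<lambda>\<omega>. \<Prod>n\<in>S. indicator (\<X> \<omega>) (int n)) \<le> s ^ card S"
      using le[of ?ns] by (simp add: distinct_map inj_on_def)
  qed
  thus ?thesis unfolding s_def[symmetric] sub_bernoulli_def using prob_space_axioms by simp
qed

text \<open>Real and imaginary parts are test sums with cosines and sines as coefficients, and the
  pairs of modulus and frequency are polynomially many in \<open>k\<close>. The two parts together
  turn the constant 3 into 6.\<close>

lemma (in sub_bernoulli) AE_small_exponential_sums:
  assumes c: "c \<ge> 1"
  shows "AE \<omega> in M. small_exponential_sums (\<lambda>n. \<xi> n \<omega> - s) P c"
proof -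
  define \<theta> where "\<theta> K j n = 2 * pi * of_int (int j * poly P (int n)) / real K" for K j n :: nat
  define I where "I k = {..k ^ (c * c)} \<times> {..<k ^ (c * c)}" for k :: nat
  define A where "A k = (\<lambda>(K, j) n. cos (\<theta> K j n)) ` I k \<union> (\<lambda>(K, j) n. sin (\<theta> K j n)) ` I k" for k
  have "AE \<omega> in M. eventually (\<lambda>k. \<forall>a\<in>A k. \<bar>\<Sum>n<k ^ (4 * c). a n * (\<xi> n \<omega> - s)\<bar> \<le> 3 * real k ^ (3 * c)) sequentially"
  proof (rule AE_test_sums[OF c])
    show "finite (A k)" for k by (simp add: A_def I_def)
    show "real (card (A k)) \<le> 4 * real k ^ (2 * (c * c))" if "k \<ge> 1" for k
    proof -
      have "card (A k) \<le> card (I k) + card (I k)"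
        unfolding A_def by (intro order.trans[OF card_Un_le] add_mono card_image_le) (simp_all add: I_def)
      also have "\<dots> = 2 * (k ^ (c * c) + 1) * k ^ (c * c)" by (simp add: I_def)
      also have "\<dots> \<le> 2 * (k ^ (c * c) + k ^ (c * c)) * k ^ (c * c)"
        using that by (intro mult_right_mono mult_left_mono add_left_mono) auto
      also have "\<dots> = 4 * k ^ (2 * (c * c))"
        by (simp add: mult_2[of "c * c"] power_add)
      finally have "card (A k) \<le> 4 * k ^ (2 * (c * c))" .
      hence "real (card (A k)) \<le> real (4 * k ^ (2 * (c * c)))" by (simp only: of_nat_le_iff)
      thus ?thesis by simp
    qed
    show "\<bar>a n\<bar> \<le> 1" if "a \<in> A k" for a k n
      using that by (auto simp: A_def)
  qed
  thus ?thesis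
  proof eventually_elim
    case (elim \<omega>)
    thus ?case
      unfolding small_exponential_sums_def
    proof eventually_elim
      case (elim k)
      show ?case
      proof (intro allI impI)
        fix K j :: nat assume K: "K \<le> k ^ (c * c)" and j: "j < K"
        let ?z = "\<Sum>n<k ^ (4 * c). of_real (\<xi> n \<omega> - s) * cis (\<theta> K j n)"
        have "(K, j) \<in> I k" using K j by (auto simp: I_def)
        hence "(\<lambda>n. cos (\<theta> K j n)) \<in> A k" "(\<lambda>n. sin (\<theta> K j n)) \<in> A k"
          unfolding A_def by force+
        hence "\<bar>Re ?z\<bar> \<le> 3 * real k ^ (3 * c)" "\<bar>Im ?z\<bar> \<le> 3 * real k ^ (3 * c)"
          using elim by (auto simp: mult.commute simp del: of_real_diff)
        hence "norm ?z \<le> 6 * real k ^ (3 * c)"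
          using cmod_le[of ?z] by linarith
        thus "norm (\<Sum>n<k ^ (4 * c). of_real (\<xi> n \<omega> - s) *
            cis (2 * pi * of_int (int j * poly P (int n)) / of_nat K)) \<le> 6 * real k ^ (3 * c)"
          unfolding \<theta>_def by simp
      qed
    qed
  qed
qed

text \<open>A polynomial is determined by its finite list of coefficients. Countability lets one
  event serve all polynomials.\<close>

lemma countable_int_poly: "countable (UNIV :: int poly set)"
  by (rule countableI'[of coeffs]) (simp add: inj_on_def coeffs_eq_iff)

(* The almost sure event must not depend on the phase space of the system, so not on the type 'x
   either, and HOL has no type quantifier below the existential one. Hence two parts: the first,
   in which 'x does not occur, provides the event for one fixed type of phase spaces; the second
   says that the property of each sample point then holds for systems on an arbitrary type 'x.
   Together: for every type 'x, each point of the event is good for all systems on 'x. *)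
theorem theorem3p1:
  fixes f :: "real \<Rightarrow> real" and \<sigma> :: real
    and \<Omega> :: "'a measure" and \<X> :: "'a \<Rightarrow> int set" and \<xi> :: "int \<Rightarrow> 'a \<Rightarrow> real"
  assumes "f \<in> borel_measurable borel"
    and "\<And>t. f (t + 1) = f t"
    and "\<And>t. 0 \<le> f t \<and> f t \<le> 1"
    and "\<sigma> = (LINT t:{0..<1}|lborel. f t)"
    and "0 < \<sigma>" and "\<sigma> < 1"
    and "determinantal_process \<Omega> (\<lambda>n m. fourier_coeff f (n - m)) \<X>"
    and "\<And>n \<omega>. \<xi> n \<omega> = indicator (\<X> \<omega>) n"
  shows "(\<exists>\<Omega>\<^sub>0 \<in> sets \<Omega>. measure \<Omega> \<Omega>\<^sub>0 = 1 \<and>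
            (\<forall>\<omega>\<in>\<Omega>\<^sub>0. averages_vanish TYPE(nat \<Rightarrow> complex) (\<lambda>n. \<xi> (int n) \<omega> - \<sigma>)))
       \<and> (\<forall>\<omega>\<in>space \<Omega>. averages_vanish TYPE(nat \<Rightarrow> complex) (\<lambda>n. \<xi> (int n) \<omega> - \<sigma>) \<longrightarrow>
            averages_vanish TYPE('x) (\<lambda>n. \<xi> (int n) \<omega> - \<sigma>))"
proof (intro conjI ballI impI)
  interpret sub_bernoulli \<Omega> "\<lambda>n \<omega>. \<xi> (int n) \<omega>" \<sigma>
    using determinantal_sub_bernoulli[OF assms(1,3,7)] by (simp add: assms(4,8))
  \<comment> \<open>Countably many conditions, fixed before any system or function is chosen. Every
    \<open>c\<close> is included because the one required later depends on \<open>r\<close> and on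
    the degree of \<open>P\<close>.\<close>
  have "AE \<omega> in \<Omega>. \<forall>P\<in>UNIV. \<forall>c\<in>{1..}. small_exponential_sums (\<lambda>n. \<xi> (int n) \<omega> - \<sigma>) P c"
    by (intro AE_ball_countable' countable_int_poly AE_small_exponential_sums) auto
  \<comment> \<open>Almost sure validity supplies an event of probability 1 inside the set of good
    points, whose own measurability is left open.\<close>
  from AE_E_prob[OF this] obtain \<Omega>\<^sub>0 where
    \<Omega>\<^sub>0: "\<Omega>\<^sub>0 \<subseteq> {\<omega> \<in> space \<Omega>. \<forall>P\<in>UNIV. \<forall>c\<in>{1..}. small_exponential_sums (\<lambda>n. \<xi> (int n) \<omega> - \<sigma>) P c}"
    "\<Omega>\<^sub>0 \<in> events" "prob \<Omega>\<^sub>0 = 1" .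
  have "averages_vanish TYPE(nat \<Rightarrow> complex) (\<lambda>n. \<xi> (int n) \<omega> - \<sigma>)" if "\<omega> \<in> \<Omega>\<^sub>0" for \<omega>
    using \<Omega>\<^sub>0(1) that by (intro averages_vanish_of_small_exponential_sums abs_centered_le) auto
  thus "\<exists>\<Omega>\<^sub>0 \<in> sets \<Omega>. measure \<Omega> \<Omega>\<^sub>0 = 1 \<and>
      (\<forall>\<omega>\<in>\<Omega>\<^sub>0. averages_vanish TYPE(nat \<Rightarrow> complex) (\<lambda>n. \<xi> (int n) \<omega> - \<sigma>))"
    using \<Omega>\<^sub>0 by blast
qed (rule averages_vanish_transfer)

end
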